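(* Let $G\le\mathrm{O}(d)$ have closed orbits. The following are equivalent: (a) the max filtering map $K([x],[y]):=\langle\!\langle[x],[y]\rangle\!\rangle$ is a positive definite kernel on $\mathbb{R}^d/G$; (b) $G$ is polar with a section $\Sigma$ such that $\mathbb{R}^d/G$ is isometric to $\Sigma/W(\Sigma,G)$, and furthermore $W(\Sigma,G)$ is a finite reflection group (acting on $\Sigma$).
   Context: For $x\in\mathbb{R}^d$, $[x]:=\{gx:g\in G\}$; $\mathbb{R}^d/G$ carries the quotient metric $d([x],[y]):=\inf_{p\in[x],q\in[y]}\|p-q\|$, and $\langle\!\langle[x],[y]\rangle\!\rangle:=\sup_{p\in[x],q\in[y]}\langle p,q\rangle$. A positive definite kernel on a set $\mathcal{X}$ is a symmetric $K:\mathcal{X}\times\mathcal{X}\to\mathbb{R}$ with $\sum_{i,j=1}^nc_ic_jK(x_i,x_j)\ge0$ for all $n$, $x_i\in\mathcal{X}$, $c_i\in\mathbb{R}$. $G$ is polar if there is a linear subspace $\Sigma\le\mathbb{R}^d$ (a section) meeting every orbit orthogonally: $G\cdot\Sigma=\mathbb{R}^d$ and for every $x\in\Sigma$ the tangent space at $x$ of the orbit $[x]$ (a smooth submanifold) lies in $\Sigma^\perp$. $W(\Sigma,G)$ is the largest subgroup of $G$ leaving $\Sigma$ invariant, acting on $\Sigma$ by restriction; $\Sigma/W(\Sigma,G)$ carries the analogous quotient metric. A finite reflection group is a finite group of orthogonal maps generated by reflections across hyperplanes. *)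

theory Defs
  imports "HOL-Analysis.Analysis" "HOL-Library.FuncSet"
begin

definition orth_group :: "('a::euclidean_space \<Rightarrow> 'a) set \<Rightarrow> bool" where
  "orth_group G \<longleftrightarrow> id \<in> G \<and> (\<forall>g\<in>G. orthogonal_transformation g)
     \<and> (\<forall>g\<in>G. \<forall>h\<in>G. g \<circ> h \<in> G) \<and> (\<forall>g\<in>G. inv g \<in> G)"

definition orb :: "('a \<Rightarrow> 'a) set \<Rightarrow> 'a \<Rightarrow> 'a set" where
  "orb G x = (\<lambda>g. g x) ` G"

definition qdist :: "'a::metric_space set \<Rightarrow> 'a set \<Rightarrow> real" where
  "qdist A B = Inf {dist p q | p q. p \<in> A \<and> q \<in> B}"

definition maxfilt :: "'a::real_inner set \<Rightarrow> 'a set \<Rightarrow> real" where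
  "maxfilt A B = Sup {p \<bullet> q | p q. p \<in> A \<and> q \<in> B}"

definition pd_kernel_on :: "'b set \<Rightarrow> ('b \<Rightarrow> 'b \<Rightarrow> real) \<Rightarrow> bool" where
  "pd_kernel_on X K \<longleftrightarrow> (\<forall>x\<in>X. \<forall>y\<in>X. K x y = K y x) \<and>
     (\<forall>(n::nat) (xs::nat \<Rightarrow> 'b) (c::nat \<Rightarrow> real). (\<forall>i<n. xs i \<in> X) \<longrightarrow>
        (\<Sum>i<n. \<Sum>j<n. c i * c j * K (xs i) (xs j)) \<ge> 0)"

definition tangent_space :: "'a::real_normed_vector set \<Rightarrow> 'a \<Rightarrow> 'a set" where
  "tangent_space M x = {v. \<exists>\<gamma>::real \<Rightarrow> 'a. (\<forall>t. \<gamma> t \<in> M) \<and> \<gamma> 0 = x \<and>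
        (\<gamma> has_vector_derivative v) (at 0)}"

definition is_section :: "('a::euclidean_space \<Rightarrow> 'a) set \<Rightarrow> 'a set \<Rightarrow> bool" where
  "is_section G \<Sigma> \<longleftrightarrow> subspace \<Sigma> \<and> (\<Union>g\<in>G. g ` \<Sigma>) = UNIV \<and>
     (\<forall>x\<in>\<Sigma>. \<forall>v\<in>tangent_space (orb G x) x. \<forall>s\<in>\<Sigma>. orthogonal v s)"

definition polar :: "('a::euclidean_space \<Rightarrow> 'a) set \<Rightarrow> bool" where
  "polar G \<longleftrightarrow> (\<exists>\<Sigma>. is_section G \<Sigma>)"

definition weyl :: "('a \<Rightarrow> 'a) set \<Rightarrow> 'a set \<Rightarrow> ('a \<Rightarrow> 'a) set" where
  "weyl G \<Sigma> = {g \<in> G. g ` \<Sigma> = \<Sigma>}"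

definition is_reflection_on :: "'a::euclidean_space set \<Rightarrow> ('a \<Rightarrow> 'a) \<Rightarrow> bool" where
  "is_reflection_on \<Sigma> r \<longleftrightarrow> (\<exists>v\<in>\<Sigma>. v \<noteq> 0 \<and>
      r = restrict (\<lambda>x. x - (2 * (x \<bullet> v) / (v \<bullet> v)) *\<^sub>R v) \<Sigma>)"

inductive_set generated_on :: "'a set \<Rightarrow> ('a \<Rightarrow> 'a) set \<Rightarrow> ('a \<Rightarrow> 'a) set"
  for \<Sigma> :: "'a set" and S :: "('a \<Rightarrow> 'a) set" where
  gen_id: "restrict id \<Sigma> \<in> generated_on \<Sigma> S"
| gen_step: "f \<in> generated_on \<Sigma> S \<Longrightarrow> s \<in> S \<Longrightarrow> restrict (s \<circ> f) \<Sigma> \<in> generated_on \<Sigma> S"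

definition finite_reflection_group_on :: "'a::euclidean_space set \<Rightarrow> ('a \<Rightarrow> 'a) set \<Rightarrow> bool" where
  "finite_reflection_group_on \<Sigma> R \<longleftrightarrow> finite R \<and>
     (\<exists>S. (\<forall>r\<in>S. is_reflection_on \<Sigma> r) \<and> R = generated_on \<Sigma> S)"

end

theory Submission
  imports Defs
begin

text \<open>
  Call \<open>x\<close> and \<open>y\<close> aligned if \<open>\<langle>x, y\<rangle>\<close> is the largest inner product between their orbits, that is, if
  \<open>K x y = \<langle>x, y\<rangle>\<close> for the max filtering \<open>K\<close>.

  If \<open>K\<close> is positive definite and \<open>x\<close>, \<open>y\<close> are aligned, then the feature vectors of \<open>x\<close> and \<open>y\<close> add
  up to that of \<open>x + y\<close>, so \<open>x + y\<close> is aligned with exactly those vectors with which both \<open>x\<close> and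
  \<open>y\<close> are. Hence a maximal pairwise aligned set \<open>A\<close> is a convex cone that contains every vector
  aligned with any point of its relative interior, and therefore meets each orbit, in exactly one
  point. The section is \<open>span A\<close>. The closure of the group is a compact Lie group, so a point \<open>g y\<close>
  of the orbit of \<open>y\<close> is the image of \<open>y\<close> under an isometry \<open>h\<close> whose distance to the identity is
  \<open>O(|g y - y|)\<close>. For \<open>a\<close>, \<open>b\<close> in \<open>A\<close> the numbers \<open>\<langle>a - h a, b\<rangle>\<close> and \<open>\<langle>a, b - h b\<rangle>\<close> are nonnegative
  with sum \<open>\<langle>h a - a, h b - b\<rangle>\<close>, hence of second order; by bilinearity \<open>\<langle>y - h y, z\<rangle>\<close> is of second
  order for all \<open>y\<close>, \<open>z\<close> in \<open>span A\<close>, and it follows that \<open>y\<close> is aligned with \<open>y + s z\<close> for small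
  \<open>s > 0\<close>. So the translates of \<open>A\<close> under the Weyl group tile \<open>span A\<close>, and crossing a wall of \<open>A\<close>
  yields the reflection in that wall.

  Conversely, a chamber of a finite reflection group is an isometric copy of the quotient in
  Euclidean space, and a quotient that embeds isometrically into an inner product space has a
  positive definite max filtering kernel by polarization.
\<close>

subsection \<open>Hyperplane reflections\<close>

definition hrefl :: "'a::real_inner \<Rightarrow> 'a \<Rightarrow> 'a" where
  "hrefl v x = x - (2 * (x \<bullet> v) / (v \<bullet> v)) *\<^sub>R v"

lemma linear_hrefl: "linear (hrefl v)"
  by (rule linearI) (simp_all add: hrefl_def algebra_simps inner_add_left add_divide_distrib)

lemma hrefl_hrefl [simp]: "hrefl v (hrefl v x) = x"
  by (cases "v = 0") (simp_all add: hrefl_def inner_diff_left)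

lemma inner_hrefl_hrefl [simp]: "hrefl v x \<bullet> hrefl v y = x \<bullet> y"
  by (cases "v = 0")
    (simp_all add: hrefl_def inner_diff_left inner_diff_right inner_commute field_simps)

lemma inner_hrefl_left: "hrefl v x \<bullet> y = x \<bullet> hrefl v y"
  by (metis hrefl_hrefl inner_hrefl_hrefl)

lemma norm_hrefl [simp]: "norm (hrefl v x) = norm x"
  by (simp add: norm_eq_sqrt_inner)

lemma hrefl_self [simp]: "hrefl v v = - v"
  by (cases "v = 0") (simp_all add: hrefl_def algebra_simps scaleR_2[symmetric])

lemma hrefl_uminus [simp]: "hrefl (- v) = hrefl v"
  by (simp add: hrefl_def fun_eq_iff)

lemma hrefl_scaleR: "c \<noteq> 0 \<Longrightarrow> hrefl (c *\<^sub>R v) = hrefl v"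
  by (simp add: hrefl_def fun_eq_iff)

lemma hrefl_orthogonal: "x \<bullet> v = 0 \<Longrightarrow> hrefl v x = x"
  by (simp add: hrefl_def)

lemma inner_hrefl_unit: "norm v = 1 \<Longrightarrow> y \<bullet> hrefl v x = y \<bullet> x - 2 * (x \<bullet> v) * (y \<bullet> v)"
  by (simp add: hrefl_def inner_diff_right dot_square_norm)

lemma hrefl_in_subspace: "subspace S \<Longrightarrow> v \<in> S \<Longrightarrow> x \<in> S \<Longrightarrow> hrefl v x \<in> S"
  by (simp add: hrefl_def subspace_diff subspace_scale)

lemma hrefl_hrefl_root: "hrefl (hrefl a v) = hrefl a \<circ> hrefl v \<circ> hrefl a"
proof
  fix x
  have "hrefl a (hrefl v (hrefl a x))
      = hrefl a (hrefl a x) - (2 * (hrefl a x \<bullet> v) / (v \<bullet> v)) *\<^sub>R hrefl a v"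
    unfolding hrefl_def[of v] by (simp add: linear_diff linear_scale linear_hrefl)
  then show "hrefl (hrefl a v) x = (hrefl a \<circ> hrefl v \<circ> hrefl a) x"
    by (simp add: hrefl_def[of "hrefl a v"] inner_hrefl_left)
qed

lemma unit_vectors_eq_or_eq_uminus:
  fixes v w :: "'a::real_inner"
  assumes "norm v = 1" "norm w = 1" "\<bar>v \<bullet> w\<bar> \<ge> 1"
  shows "v = w \<or> v = - w"
proof -
  have "\<bar>v \<bullet> w\<bar> = norm v * norm w"
    using Cauchy_Schwarz_ineq2[of v w] assms by simp
  then show ?thesis
    unfolding norm_cauchy_schwarz_abs_eq using assms by auto
qed

lemma unit_eq_if_hrefl_eq_uminus:
  assumes "norm v = 1" "norm w = 1" "hrefl v w = - w"
  shows "w = v \<or> w = - v"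
proof -
  have "- (w \<bullet> w) = w \<bullet> w - 2 * (w \<bullet> v)\<^sup>2"
    using inner_hrefl_unit[OF assms(1), of w w] assms(3) by (simp add: power2_eq_square)
  then have "(w \<bullet> v)\<^sup>2 = 1"
    using assms(2) by (simp add: dot_square_norm)
  then show ?thesis
    using assms by (intro unit_vectors_eq_or_eq_uminus) (auto simp: power2_eq_1_iff)
qed

abbreviation refl_word :: "'a::real_inner list \<Rightarrow> 'a \<Rightarrow> 'a" where
  "refl_word \<equiv> foldr hrefl"

lemma linear_refl_word: "linear (refl_word vs)"
proof (induction vs)
  case (Cons v vs)
  then show ?case
    using linear_compose[OF _ linear_hrefl] by (simp add: o_def)
qed (simp add: linear_ident)

lemma hrefl_refl_word: "hrefl (refl_word vs v) \<circ> refl_word vs = refl_word vs \<circ> hrefl v"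
proof (induction vs)
  case (Cons a vs)
  then show ?case
    by (auto simp: hrefl_hrefl_root fun_eq_iff)
qed simp

lemma refl_word_closed:
  assumes "\<And>a b. a \<in> S \<Longrightarrow> b \<in> T \<Longrightarrow> hrefl a b \<in> T" "vs \<in> lists S" "x \<in> T"
  shows "refl_word vs x \<in> T"
  using assms(2) by (induction vs) (use assms(1,3) in auto)

lemma is_reflection_on_iff:
  assumes "subspace S"
  shows "is_reflection_on S r \<longleftrightarrow> (\<exists>v\<in>S. norm v = 1 \<and> r = restrict (hrefl v) S)"
proof
  assume "is_reflection_on S r"
  then obtain v where v: "v \<in> S" "v \<noteq> 0" "r = restrict (hrefl v) S"
    by (auto simp: is_reflection_on_def hrefl_def[abs_def])
  then have "hrefl (v /\<^sub>R norm v) = hrefl v"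
    by (intro hrefl_scaleR) simp
  then show "\<exists>v\<in>S. norm v = 1 \<and> r = restrict (hrefl v) S"
    using v assms by (intro bexI[of _ "v /\<^sub>R norm v"]) (simp_all add: subspace_scale)
next
  assume "\<exists>v\<in>S. norm v = 1 \<and> r = restrict (hrefl v) S"
  then obtain v where "v \<in> S" "v \<noteq> 0" "r = restrict (hrefl v) S"
    by (metis norm_zero zero_neq_one)
  then show "is_reflection_on S r"
    by (auto simp: is_reflection_on_def hrefl_def[abs_def])
qed

lemma restrict_refl_word_Cons:
  assumes "subspace S" "vs \<in> lists S"
  shows "restrict (refl_word (v # vs)) S =
    restrict (restrict (hrefl v) S \<circ> restrict (refl_word vs) S) S"
proof -
  have "refl_word vs x \<in> S" if "x \<in> S" for x
    by (rule refl_word_closed[OF _ assms(2) that]) (rule hrefl_in_subspace[OF assms(1)])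
  then show ?thesis
    by (simp add: restrict_def fun_eq_iff)
qed

lemma generated_on_hrefl:
  assumes "subspace S" "N \<subseteq> S"
  shows "generated_on S ((\<lambda>v. restrict (hrefl v) S) ` N) = (\<lambda>vs. restrict (refl_word vs) S) ` lists N"
proof (intro equalityI subsetI)
  have words: "lists N \<subseteq> lists S"
    using assms(2) by (rule lists_mono)
  show "f \<in> (\<lambda>vs. restrict (refl_word vs) S) ` lists N"
    if "f \<in> generated_on S ((\<lambda>v. restrict (hrefl v) S) ` N)" for f
    using that
  proof induction
    case gen_id
    show ?case
      by (rule image_eqI[of _ _ "[]"]) (simp_all only: foldr.simps lists.Nil)
  next
    case (gen_step f s)
    then obtain v vs where "v \<in> N" "s = restrict (hrefl v) S"
      and vs: "vs \<in> lists N" "f = restrict (refl_word vs) S"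
      by blast
    then show ?case
      using restrict_refl_word_Cons[OF assms(1) subsetD[OF words vs(1)], of v]
      by (intro image_eqI[of _ _ "v # vs"]) (simp_all only: lists.Cons)
  qed
  have "restrict (refl_word vs) S \<in> generated_on S ((\<lambda>v. restrict (hrefl v) S) ` N)"
    if "vs \<in> lists N" for vs
    using that
  proof induction
    case Nil
    show ?case
      unfolding foldr.simps by (rule generated_on.gen_id)
  next
    case (Cons v vs)
    show ?case
      unfolding restrict_refl_word_Cons[OF assms(1) subsetD[OF words Cons.hyps(2)]]
      by (rule generated_on.gen_step[OF Cons.IH imageI[OF Cons.hyps(1)]])
  qed
  then show "f \<in> generated_on S ((\<lambda>v. restrict (hrefl v) S) ` N)"
    if "f \<in> (\<lambda>vs. restrict (refl_word vs) S) ` lists N" for f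
    using that by blast
qed

subsection \<open>Facets of dual cones\<close>

definition dual_cone :: "'a::real_inner set \<Rightarrow> 'a set \<Rightarrow> 'a set" where
  "dual_cone S N = {u \<in> S. \<forall>v\<in>N. 0 \<le> u \<bullet> v}"

definition facet_point :: "'a::real_inner set \<Rightarrow> 'a set \<Rightarrow> 'a \<Rightarrow> 'a \<Rightarrow> bool" where
  "facet_point S N v p \<longleftrightarrow> p \<in> S \<and> p \<bullet> v = 0 \<and> (\<forall>w\<in>N - {v}. 0 < p \<bullet> w)"

lemma facet_point_imp_dual_cone:
  assumes "facet_point S N v p"
  shows "p \<in> dual_cone S N"
proof -
  have "0 \<le> p \<bullet> w" if "w \<in> N" for w
    using assms that by (cases "w = v") (auto simp: facet_point_def intro: less_imp_le)
  then show ?thesis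
    using assms by (simp add: facet_point_def dual_cone_def)
qed

lemma facet_point_if_separated:
  assumes "subspace S" "\<rho> \<in> S" "q \<in> S"
    and "\<And>w. w \<in> N - {v} \<Longrightarrow> 0 < \<rho> \<bullet> w" "\<And>w. w \<in> N - {v} \<Longrightarrow> 0 \<le> q \<bullet> w"
    and "0 < \<rho> \<bullet> v" "q \<bullet> v < 0"
  shows "facet_point S N v ((- (q \<bullet> v)) *\<^sub>R \<rho> + (\<rho> \<bullet> v) *\<^sub>R q)"
  unfolding facet_point_def
proof (intro conjI ballI)
  fix w assume w: "w \<in> N - {v}"
  have "0 < (- (q \<bullet> v)) * (\<rho> \<bullet> w)" "0 \<le> (\<rho> \<bullet> v) * (q \<bullet> w)"
    using assms(4,5)[OF w] assms(6,7) by (auto intro!: mult_pos_pos simp: mult_neg_pos)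
  then show "0 < ((- (q \<bullet> v)) *\<^sub>R \<rho> + (\<rho> \<bullet> v) *\<^sub>R q) \<bullet> w"
    unfolding inner_add_left inner_scaleR_left by (rule add_pos_nonneg)
next
  show "(- (q \<bullet> v)) *\<^sub>R \<rho> + (\<rho> \<bullet> v) *\<^sub>R q \<in> S"
    by (intro subspace_add subspace_scale assms(1-3))
  show "((- (q \<bullet> v)) *\<^sub>R \<rho> + (\<rho> \<bullet> v) *\<^sub>R q) \<bullet> v = 0"
    by (simp add: inner_diff_left)
qed

lemma ex_irredundant_dual_cone:
  assumes "subspace S" "finite N" "\<rho> \<in> S" and pos: "\<And>v. v \<in> N \<Longrightarrow> 0 < \<rho> \<bullet> v"
  obtains M where "M \<subseteq> N" "dual_cone S M = dual_cone S N" "\<forall>v\<in>M. \<exists>p. facet_point S M v p"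
proof -
  obtain M where M: "M \<subseteq> N" "dual_cone S M = dual_cone S N"
    and minimal: "\<And>M'. M' \<subseteq> N \<Longrightarrow> dual_cone S M' = dual_cone S N \<Longrightarrow> card M \<le> card M'"
    using ex_has_least_nat[of "\<lambda>M. M \<subseteq> N \<and> dual_cone S M = dual_cone S N" N card] by auto
  show thesis
  proof (rule that[OF M], rule ballI)
    fix v assume v: "v \<in> M"
    have "finite M"
      using M(1) assms(2) by (rule finite_subset)
    then have "dual_cone S (M - {v}) \<noteq> dual_cone S M"
      using minimal[of "M - {v}"] M v by (metis Diff_subset card_Diff1_less leD subset_trans)
    then obtain q where q: "q \<in> S" "\<And>w. w \<in> M - {v} \<Longrightarrow> 0 \<le> q \<bullet> w" "q \<bullet> v < 0"
      by (force simp: dual_cone_def not_le)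
    have "facet_point S M v ((- (q \<bullet> v)) *\<^sub>R \<rho> + (\<rho> \<bullet> v) *\<^sub>R q)"
      using M(1) v by (intro facet_point_if_separated assms(1,3) q pos) auto
    then show "\<exists>p. facet_point S M v p" ..
  qed
qed

lemma eventually_inner_pos:
  fixes p d :: "'a::real_inner"
  assumes "finite N" "\<And>v. v \<in> N \<Longrightarrow> 0 < p \<bullet> v"
  shows "\<forall>\<^sub>F t in at_right 0. \<forall>v\<in>N. 0 < (p + t *\<^sub>R d) \<bullet> v"
proof (rule eventually_ball_finite[OF assms(1)], rule ballI)
  fix v assume "v \<in> N"
  have "((\<lambda>t. (p + t *\<^sub>R d) \<bullet> v) \<longlongrightarrow> (p + 0 *\<^sub>R d) \<bullet> v) (at_right 0)"
    by (intro tendsto_intros)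
  then show "\<forall>\<^sub>F t in at_right 0. 0 < (p + t *\<^sub>R d) \<bullet> v"
    by (rule order_tendstoD(1)) (simp add: assms(2) \<open>v \<in> N\<close>)
qed

lemma eventually_at_right_ex:
  fixes a :: real
  assumes "\<forall>\<^sub>F t in at_right a. P t"
  obtains t where "a < t" "P t"
  using eventually_happens'[OF trivial_limit_at_right_real eventually_conj[OF eventually_at_right_less assms]]
  by blast

lemma eventually_facet_point_dual_cone:
  assumes "subspace S" "finite N" "facet_point S N v p" "d \<in> S" "0 \<le> d \<bullet> v"
  shows "\<forall>\<^sub>F t in at_right 0. p + t *\<^sub>R d \<in> dual_cone S N"
proof -
  have p: "p \<in> S" "p \<bullet> v = 0" "\<And>w. w \<in> N - {v} \<Longrightarrow> 0 < p \<bullet> w"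
    using assms(3) by (auto simp: facet_point_def)
  have "\<forall>\<^sub>F t in at_right 0. \<forall>w\<in>N - {v}. 0 < (p + t *\<^sub>R d) \<bullet> w"
    using assms(2) p(3) by (intro eventually_inner_pos) auto
  with eventually_at_right_less show ?thesis
  proof eventually_elim
    case (elim t)
    have "0 \<le> (p + t *\<^sub>R d) \<bullet> w" if "w \<in> N" for w
    proof (cases "w = v")
      case True
      then show ?thesis
        using p assms(5) elim(1) by (simp add: inner_add_left)
    next
      case False
      then show ?thesis
        using elim(2) that by (blast intro: less_imp_le)
    qed
    then show ?case
      using assms(1,4) p(1) by (simp add: dual_cone_def subspace_add subspace_scale)
  qed
qed

subsection \<open>Chambers of finite root systems\<close>

locale root_set =
  fixes \<Phi> :: "'a::real_inner set" and \<rho> :: 'a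
  assumes finite_roots: "finite \<Phi>"
    and norm_root: "a \<in> \<Phi> \<Longrightarrow> norm a = 1"
    and hrefl_root: "a \<in> \<Phi> \<Longrightarrow> b \<in> \<Phi> \<Longrightarrow> hrefl a b \<in> \<Phi>"
    and regular: "a \<in> \<Phi> \<Longrightarrow> \<rho> \<bullet> a \<noteq> 0"
begin

definition pos_roots :: "'a set" where "pos_roots = {a \<in> \<Phi>. 0 < \<rho> \<bullet> a}"

definition chamber :: "'a set" where "chamber = dual_cone UNIV pos_roots"

lemma pos_rootsD:
  assumes "a \<in> pos_roots"
  shows "a \<in> \<Phi>" "norm a = 1" "0 < \<rho> \<bullet> a" "- a \<notin> pos_roots"
  using assms norm_root by (auto simp: pos_roots_def)

lemma finite_pos_roots: "finite pos_roots"
  using finite_roots by (simp add: pos_roots_def)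

lemma pos_roots_cases: "a \<in> \<Phi> \<Longrightarrow> a \<in> pos_roots \<or> - a \<in> pos_roots"
  using regular[of a] hrefl_root[of a a] by (auto simp: pos_roots_def)

lemma chamberD: "x \<in> chamber \<Longrightarrow> a \<in> pos_roots \<Longrightarrow> 0 \<le> x \<bullet> a"
  by (simp add: chamber_def dual_cone_def)

definition simple_system :: "'a set \<Rightarrow> bool" where
  "simple_system \<Delta> \<longleftrightarrow> \<Delta> \<subseteq> pos_roots \<and> dual_cone UNIV \<Delta> = chamber \<and>
    (\<forall>\<delta>\<in>\<Delta>. \<forall>v\<in>pos_roots - {\<delta>}. hrefl \<delta> v \<in> pos_roots)"

lemma inner_facet_point_pos_root:
  assumes \<Delta>: "\<Delta> \<subseteq> pos_roots" "dual_cone UNIV \<Delta> = chamber" and \<delta>: "\<delta> \<in> \<Delta>"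
    and p: "facet_point UNIV \<Delta> \<delta> p" and v: "v \<in> pos_roots" "v \<noteq> \<delta>"
  shows "0 < p \<bullet> v"
proof -
  have unit: "norm v = 1" "norm \<delta> = 1" and "- v \<noteq> \<delta>"
    using pos_rootsD[OF v(1)] pos_rootsD[of \<delta>] \<delta> \<Delta>(1) by auto
  have "p \<bullet> v \<noteq> 0"
  proof
    assume "p \<bullet> v = 0"
    define d where "d = (v \<bullet> \<delta>) *\<^sub>R \<delta> - v"
    have "d \<bullet> \<delta> = 0"
      using unit by (simp add: d_def inner_diff_left dot_square_norm)
    then have "\<forall>\<^sub>F t in at_right 0. p + t *\<^sub>R d \<in> dual_cone UNIV \<Delta>"
      using finite_subset[OF \<Delta>(1) finite_pos_roots] p by (intro eventually_facet_point_dual_cone) auto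
    then obtain t where t: "0 < t" "p + t *\<^sub>R d \<in> chamber"
      unfolding \<Delta>(2) by (rule eventually_at_right_ex)
    have "0 \<le> t * (d \<bullet> v)"
      using chamberD[OF t(2) v(1)] \<open>p \<bullet> v = 0\<close> by (simp add: inner_add_left)
    then have "0 \<le> d \<bullet> v"
      using t(1) by (simp add: zero_le_mult_iff)
    then have "1 \<le> (v \<bullet> \<delta>)\<^sup>2"
      using unit
      by (simp add: d_def inner_diff_left dot_square_norm inner_commute[of \<delta>] power2_eq_square)
    then have "v = \<delta> \<or> v = - \<delta>"
      using unit
      by (intro unit_vectors_eq_or_eq_uminus) (simp_all add: abs_le_square_iff[of 1, simplified])
    then show False
      using v(2) \<open>- v \<noteq> \<delta>\<close> by auto
  qed
  moreover have "0 \<le> p \<bullet> v"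
    using chamberD[OF _ v(1)] facet_point_imp_dual_cone[OF p] \<Delta>(2) by blast
  ultimately show ?thesis
    by simp
qed

lemma ex_simple_system: "\<exists>\<Delta>. simple_system \<Delta>"
proof -
  obtain \<Delta> where \<Delta>: "\<Delta> \<subseteq> pos_roots" "dual_cone UNIV \<Delta> = chamber"
    and facet: "\<forall>\<delta>\<in>\<Delta>. \<exists>p. facet_point UNIV \<Delta> \<delta> p"
    using ex_irredundant_dual_cone[OF subspace_UNIV finite_pos_roots UNIV_I pos_rootsD(3)]
    unfolding chamber_def .
  have "hrefl \<delta> v \<in> pos_roots" if \<delta>: "\<delta> \<in> \<Delta>" and v: "v \<in> pos_roots - {\<delta>}" for \<delta> v
  proof -
    obtain p where p: "facet_point UNIV \<Delta> \<delta> p"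
      using facet \<delta> by blast
    then have "p \<bullet> hrefl \<delta> v = p \<bullet> v"
      by (metis facet_point_def hrefl_orthogonal inner_hrefl_left)
    moreover have "0 < p \<bullet> v"
      using v by (intro inner_facet_point_pos_root[OF \<Delta> \<delta> p]) auto
    moreover have "p \<in> chamber"
      using facet_point_imp_dual_cone[OF p] \<Delta>(2) by simp
    ultimately have "- hrefl \<delta> v \<notin> pos_roots"
      using chamberD[of p "- hrefl \<delta> v"] by auto
    then show ?thesis
      using pos_roots_cases[of "hrefl \<delta> v"] hrefl_root[of \<delta> v] pos_rootsD(1) \<delta> v \<Delta>(1) by blast
  qed
  then show ?thesis
    using \<Delta> unfolding simple_system_def by blast
qed

definition simple_roots :: "'a set" where "simple_roots = (SOME \<Delta>. simple_system \<Delta>)"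

lemma simple_system_simple_roots: "simple_system simple_roots"
  unfolding simple_roots_def using ex_simple_system by (rule someI_ex)

lemma simple_roots_subset_pos: "simple_roots \<subseteq> pos_roots"
  and chamber_eq_dual_cone_simple: "chamber = dual_cone UNIV simple_roots"
  and hrefl_simple_root_pos: "\<delta> \<in> simple_roots \<Longrightarrow> v \<in> pos_roots \<Longrightarrow> v \<noteq> \<delta> \<Longrightarrow> hrefl \<delta> v \<in> pos_roots"
  using simple_system_simple_roots by (auto simp: simple_system_def)

lemma simple_roots_subset: "simple_roots \<subseteq> \<Phi>"
  using simple_roots_subset_pos pos_rootsD(1) by blast

lemma simple_word_deletion:
  assumes "\<delta> \<in> simple_roots" "vs \<in> lists simple_roots" "refl_word vs \<delta> \<notin> pos_roots"
  obtains us where "us \<in> lists simple_roots" "length us < length vs"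
    "refl_word vs \<circ> hrefl \<delta> = refl_word us"
  using assms(2,3)
proof (induction vs arbitrary: thesis)
  case Nil
  then show ?case
    using assms(1) simple_roots_subset_pos by auto
next
  case (Cons a vs)
  show ?case
  proof (cases "refl_word vs \<delta> \<in> pos_roots")
    case True
    then have "refl_word vs \<delta> = a"
      using hrefl_simple_root_pos Cons.prems(2) Cons.hyps by auto
    then have "hrefl a (refl_word vs (hrefl \<delta> x)) = refl_word vs x" for x
      using fun_cong[OF hrefl_refl_word[of vs \<delta>], of "hrefl \<delta> x"] by simp
    then show ?thesis
      using Cons.prems(1)[of vs] Cons.hyps by (simp add: fun_eq_iff)
  next
    case False
    then obtain us where "us \<in> lists simple_roots" "length us < length vs"
      "refl_word vs \<circ> hrefl \<delta> = refl_word us"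
      using Cons.IH by blast
    then show ?thesis
      using Cons.prems(1)[of "a # us"] Cons.hyps by (simp add: fun_eq_iff)
  qed
qed

lemma simple_word_inner_le:
  assumes "x \<in> chamber" "y \<in> chamber" "vs \<in> lists simple_roots"
  shows "x \<bullet> refl_word vs y \<le> x \<bullet> y"
  using assms(3)
proof (induction "length vs" arbitrary: vs rule: less_induct)
  case less
  show ?case
  proof (cases vs rule: rev_cases)
    case (snoc us \<delta>)
    then have us: "us \<in> lists simple_roots" and \<delta>: "\<delta> \<in> simple_roots"
      using less.prems by auto
    show ?thesis
    proof (cases "refl_word us \<delta> \<in> pos_roots")
      case True
      have "0 \<le> 2 * (y \<bullet> \<delta>) * (x \<bullet> refl_word us \<delta>)"
        using chamberD assms(1,2) \<delta> simple_roots_subset_pos True by (intro mult_nonneg_nonneg) auto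
      moreover have "norm \<delta> = 1"
        using \<delta> simple_roots_subset_pos pos_rootsD(2) by blast
      then have "refl_word vs y = refl_word us y - (2 * (y \<bullet> \<delta>)) *\<^sub>R refl_word us \<delta>"
        by (simp add: snoc hrefl_def dot_square_norm linear_diff linear_scale linear_refl_word)
      ultimately show ?thesis
        using less.hyps[OF _ us] by (simp add: snoc inner_diff_right)
    next
      case False
      then obtain ws where ws: "ws \<in> lists simple_roots" "length ws < length us"
        "refl_word us \<circ> hrefl \<delta> = refl_word ws"
        using simple_word_deletion[OF \<delta> us] by blast
      then have "refl_word vs y = refl_word ws y"
        by (simp add: snoc flip: ws(3))
      then show ?thesis
        using less.hyps[OF _ ws(1)] ws(2) by (simp add: snoc)
    qed
  qed simp
qed

lemma ex_simple_root_inner_pos: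
  assumes "v \<in> pos_roots"
  obtains \<delta> where "\<delta> \<in> simple_roots" "0 < v \<bullet> \<delta>"
proof (rule ccontr)
  assume "\<not> thesis"
  then have "\<forall>\<delta>\<in>simple_roots. v \<bullet> \<delta> \<le> 0"
    using that by (auto simp: not_less[symmetric])
  then have "- v \<in> chamber"
    by (simp add: chamber_eq_dual_cone_simple dual_cone_def)
  then show False
    using chamberD[OF _ assms] pos_rootsD(2)[OF assms] by (force simp: dot_square_norm)
qed

lemma hrefl_pos_root_eq_simple_word:
  assumes "v \<in> pos_roots"
  shows "\<exists>vs\<in>lists simple_roots. hrefl v = refl_word vs"
  using assms
proof (induction "card {a \<in> pos_roots. \<rho> \<bullet> a < \<rho> \<bullet> v}" arbitrary: v rule: less_induct)
  case less
  show ?case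
  proof (cases "v \<in> simple_roots")
    case True
    then show ?thesis
      by (intro bexI[of _ "[v]"]) auto
  next
    case False
    obtain \<delta> where \<delta>: "\<delta> \<in> simple_roots" "0 < v \<bullet> \<delta>"
      using ex_simple_root_inner_pos[OF less.prems] by blast
    have reflected: "hrefl \<delta> v \<in> pos_roots"
      using hrefl_simple_root_pos[OF \<delta>(1) less.prems] False \<delta>(1) by blast
    have "norm \<delta> = 1" "0 < \<rho> \<bullet> \<delta>"
      using pos_rootsD \<delta>(1) simple_roots_subset_pos by blast+
    then have "\<rho> \<bullet> hrefl \<delta> v < \<rho> \<bullet> v"
      using \<delta>(2) by (simp add: inner_hrefl_unit)
    then have "card {a \<in> pos_roots. \<rho> \<bullet> a < \<rho> \<bullet> hrefl \<delta> v} < card {a \<in> pos_roots. \<rho> \<bullet> a < \<rho> \<bullet> v}"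
      using reflected finite_pos_roots by (intro psubset_card_mono) auto
    then obtain vs where vs: "vs \<in> lists simple_roots" "hrefl (hrefl \<delta> v) = refl_word vs"
      using less.hyps reflected by blast
    have "hrefl v = hrefl \<delta> \<circ> hrefl (hrefl \<delta> v) \<circ> hrefl \<delta>"
      by (simp add: hrefl_hrefl_root fun_eq_iff)
    also have "\<dots> = refl_word (\<delta> # vs @ [\<delta>])"
      by (simp add: vs(2) fun_eq_iff)
    finally show ?thesis
      using vs(1) \<delta>(1) by (intro bexI[of _ "\<delta> # vs @ [\<delta>]"]) auto
  qed
qed

lemma word_eq_simple_word:
  assumes "vs \<in> lists \<Phi>"
  shows "\<exists>us\<in>lists simple_roots. refl_word vs = refl_word us"
  using assms
proof induction
  case Nil
  show ?case
    by (intro bexI[of _ "[]"]) simp_all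
next
  case (Cons v vs)
  then obtain us where us: "us \<in> lists simple_roots" "refl_word vs = refl_word us"
    by blast
  obtain ws where ws: "ws \<in> lists simple_roots" "hrefl v = refl_word ws"
    using pos_roots_cases[OF Cons.hyps(1)] hrefl_pos_root_eq_simple_word[of v]
      hrefl_pos_root_eq_simple_word[of "- v"]
    by auto
  show ?case
    using us ws by (intro bexI[of _ "ws @ us"]) (auto simp: fun_eq_iff)
qed

lemma chamber_word_inner_le:
  "x \<in> chamber \<Longrightarrow> y \<in> chamber \<Longrightarrow> vs \<in> lists \<Phi> \<Longrightarrow> x \<bullet> refl_word vs y \<le> x \<bullet> y"
  using word_eq_simple_word simple_word_inner_le by metis

lemma card_negative_hrefl_less:
  assumes "\<delta> \<in> simple_roots" "x \<bullet> \<delta> < 0"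
  shows "card {a \<in> pos_roots. hrefl \<delta> x \<bullet> a < 0} < card {a \<in> pos_roots. x \<bullet> a < 0}"
proof -
  have \<delta>: "\<delta> \<in> pos_roots"
    using assms(1) simple_roots_subset_pos by blast
  have "hrefl \<delta> a \<in> {a \<in> pos_roots. x \<bullet> a < 0} - {\<delta>}" if a: "a \<in> pos_roots" "hrefl \<delta> x \<bullet> a < 0" for a
  proof -
    have "a \<noteq> \<delta>"
      using a(2) assms(2) by (auto simp: inner_hrefl_left)
    moreover have "hrefl \<delta> a \<noteq> \<delta>"
      using pos_rootsD(4)[OF \<delta>] a(1) by (metis hrefl_hrefl hrefl_self)
    ultimately show ?thesis
      using hrefl_simple_root_pos[OF assms(1) a(1)] a(2) by (simp add: inner_hrefl_left)
  qed
  moreover have "inj_on (hrefl \<delta>) {a \<in> pos_roots. hrefl \<delta> x \<bullet> a < 0}"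
    by (rule inj_on_inverseI[of _ "hrefl \<delta>"]) simp
  ultimately have "card {a \<in> pos_roots. hrefl \<delta> x \<bullet> a < 0} \<le> card ({a \<in> pos_roots. x \<bullet> a < 0} - {\<delta>})"
    using finite_pos_roots by (intro card_inj_on_le[of "hrefl \<delta>"]) auto
  also have "\<dots> < card {a \<in> pos_roots. x \<bullet> a < 0}"
    using finite_pos_roots \<delta> assms(2) by (intro card_Diff1_less) auto
  finally show ?thesis .
qed

lemma ex_word_in_chamber: "\<exists>vs\<in>lists \<Phi>. refl_word vs x \<in> chamber"
proof (induction "card {a \<in> pos_roots. x \<bullet> a < 0}" arbitrary: x rule: less_induct)
  case less
  show ?case
  proof (cases "x \<in> chamber")
    case True
    then show ?thesis
      by (intro bexI[of _ "[]"]) simp_all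
  next
    case False
    then obtain \<delta> where \<delta>: "\<delta> \<in> simple_roots" "x \<bullet> \<delta> < 0"
      by (auto simp: chamber_eq_dual_cone_simple dual_cone_def not_le)
    then obtain vs where "vs \<in> lists \<Phi>" "refl_word vs (hrefl \<delta> x) \<in> chamber"
      using less card_negative_hrefl_less by blast
    then show ?thesis
      using \<delta>(1) simple_roots_subset by (intro bexI[of _ "vs @ [\<delta>]"]) auto
  qed
qed

end

subsection \<open>Alignment under groups of orthogonal maps\<close>

lemma qdist_eqI:
  assumes "p \<in> A" "q \<in> B" "\<And>p' q'. p' \<in> A \<Longrightarrow> q' \<in> B \<Longrightarrow> dist p q \<le> dist p' q'"
  shows "qdist A B = dist p q"
  unfolding qdist_def by (rule cInf_eq_minimum) (use assms in blast)+

lemma dist_power2_eq_inner: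
  fixes x y :: "'a::real_inner"
  shows "(dist x y)\<^sup>2 = x \<bullet> x + y \<bullet> y - 2 * (x \<bullet> y)"
  by (simp add: dist_norm power2_norm_eq_inner inner_diff_left inner_diff_right inner_commute)

locale orthogonal_group =
  fixes G :: "('a::euclidean_space \<Rightarrow> 'a) set"
  assumes orth_group: "orth_group G"
begin

lemma id_mem: "id \<in> G"
  and comp_mem: "g \<in> G \<Longrightarrow> h \<in> G \<Longrightarrow> g \<circ> h \<in> G"
  and inv_mem: "g \<in> G \<Longrightarrow> inv g \<in> G"
  and orthogonal_act: "g \<in> G \<Longrightarrow> orthogonal_transformation g"
  using orth_group by (auto simp: orth_group_def)

lemma linear_act: "g \<in> G \<Longrightarrow> linear g"
  and inner_act: "g \<in> G \<Longrightarrow> g x \<bullet> g y = x \<bullet> y"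
  and norm_act: "g \<in> G \<Longrightarrow> norm (g x) = norm x"
  and inj_act: "g \<in> G \<Longrightarrow> inj g"
  and inv_act: "g \<in> G \<Longrightarrow> inv g (g x) = x"
  and act_inv: "g \<in> G \<Longrightarrow> g (inv g x) = x"
  using orthogonal_act[of g] orthogonal_transformation_bij[of g]
  by (auto simp: orthogonal_transformation_def orthogonal_transformation_norm bij_is_inj bij_is_surj
      surj_f_inv_f)

lemma dist_act: "g \<in> G \<Longrightarrow> dist (g x) (g y) = dist x y"
  using orthogonal_act[of g] by (simp add: orthogonal_transformation_isometry)

lemma inner_act_left: "g \<in> G \<Longrightarrow> g x \<bullet> y = x \<bullet> inv g y"
  using inner_act[of g x "inv g y"] by (simp add: act_inv)

lemma orb_self: "x \<in> orb G x"
  unfolding orb_def using id_mem by (metis id_apply image_eqI)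

lemma orb_mem: "g \<in> G \<Longrightarrow> g x \<in> orb G x"
  by (auto simp: orb_def)

lemma orb_act:
  assumes "g \<in> G"
  shows "orb G (g x) = orb G x"
proof -
  have le: "orb G (h z) \<subseteq> orb G z" if "h \<in> G" for h z
    using orb_mem[OF comp_mem[OF _ that], of _ z] by (auto simp: orb_def)
  show ?thesis
    using le[OF assms, of x] le[OF inv_mem[OF assms], of "g x"] by (simp add: inv_act assms)
qed

lemma orth_group_weyl: "orth_group (weyl G S)"
  unfolding orth_group_def
proof (intro conjI ballI)
  show "id \<in> weyl G S"
    by (simp add: weyl_def id_mem)
  fix g assume g: "g \<in> weyl G S"
  then have "g \<in> G" "g ` S = S"
    by (simp_all add: weyl_def)
  then have "inv g ` S = inv g ` g ` S"
    by simp
  also have "\<dots> = S"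
    using \<open>g \<in> G\<close> by (simp add: image_image inv_act)
  finally show "inv g \<in> weyl G S"
    using \<open>g \<in> G\<close> by (simp add: weyl_def inv_mem)
  show "orthogonal_transformation g"
    using \<open>g \<in> G\<close> by (rule orthogonal_act)
  show "g \<circ> h \<in> weyl G S" if "h \<in> weyl G S" for h
    using g that image_comp[of g h S] by (simp add: weyl_def comp_mem)
qed

definition aligned :: "'a \<Rightarrow> 'a \<Rightarrow> bool" where
  "aligned x y \<longleftrightarrow> (\<forall>g\<in>G. g x \<bullet> y \<le> x \<bullet> y)"

lemma aligned_act_le:
  assumes "aligned x y" "g \<in> G" "h \<in> G"
  shows "g x \<bullet> h y \<le> x \<bullet> y"
proof -
  have "g x \<bullet> h y = (inv h \<circ> g) x \<bullet> y"
    by (simp add: inner_commute[of "g x"] inner_commute[of _ y] inner_act_left assms(3))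
  also have "\<dots> \<le> x \<bullet> y"
    using assms comp_mem inv_mem unfolding aligned_def by blast
  finally show ?thesis .
qed

lemma aligned_sym: "aligned x y \<Longrightarrow> aligned y x"
  using aligned_act_le[OF _ id_mem] by (auto simp: aligned_def inner_commute)

lemma aligned_refl: "aligned x x"
  unfolding aligned_def using norm_cauchy_schwarz[of _ x] norm_act
  by (metis power2_eq_square power2_norm_eq_inner)

lemma aligned_act_iff:
  assumes "g \<in> G"
  shows "aligned (g x) (g y) \<longleftrightarrow> aligned x y"
proof -
  have act: "aligned (h u) (h v)" if "aligned u v" "h \<in> G" for h u v
    using aligned_act_le[OF that(1) comp_mem[OF _ that(2)] that(2)]
    by (simp add: aligned_def inner_act that(2))
  show ?thesis
    using act[of x y g] act[of "g x" "g y" "inv g"] by (auto simp: inv_act inv_mem assms)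
qed

lemma aligned_zero: "aligned 0 x"
  by (simp add: aligned_def linear_0[OF linear_act])

lemma aligned_scaleR: "aligned x y \<Longrightarrow> 0 \<le> c \<Longrightarrow> aligned (c *\<^sub>R x) y"
  by (simp add: aligned_def linear_scale[OF linear_act] mult_left_mono)

lemma aligned_add_right: "aligned x y \<Longrightarrow> aligned x z \<Longrightarrow> aligned x (y + z)"
  by (simp add: aligned_def inner_add_right add_mono)

lemma aligned_act_self_iff:
  assumes "g \<in> G"
  shows "aligned x (g x) \<longleftrightarrow> g x = x"
proof
  assume "aligned x (g x)"
  then have "x \<bullet> x \<le> x \<bullet> g x"
    using aligned_act_le[OF _ assms id_mem, of x "g x"] by (simp add: inner_act assms)
  then have "(dist (g x) x)\<^sup>2 \<le> 0"
    by (simp add: dist_power2_eq_inner inner_act assms inner_commute)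
  then show "g x = x"
    by simp
qed (simp add: aligned_refl)

lemma qdist_orb_aligned:
  assumes "aligned x y"
  shows "qdist (orb G x) (orb G y) = dist x y"
proof (rule qdist_eqI[OF orb_self orb_self])
  fix p q assume "p \<in> orb G x" "q \<in> orb G y"
  then obtain g h where "g \<in> G" "h \<in> G" "p = g x" "q = h y"
    by (auto simp: orb_def)
  then have "(dist x y)\<^sup>2 \<le> (dist p q)\<^sup>2"
    using aligned_act_le[OF assms] by (simp add: dist_power2_eq_inner inner_act)
  then show "dist x y \<le> dist p q"
    by (rule power2_le_imp_le) simp
qed

definition aligned_set :: "'a set \<Rightarrow> bool" where
  "aligned_set A \<longleftrightarrow> (\<forall>a\<in>A. \<forall>b\<in>A. aligned a b)"

lemma aligned_setD: "aligned_set A \<Longrightarrow> a \<in> A \<Longrightarrow> b \<in> A \<Longrightarrow> aligned a b"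
  by (simp add: aligned_set_def)

lemma aligned_set_empty: "aligned_set {}"
  by (simp add: aligned_set_def)

lemma aligned_set_insert:
  "aligned_set (insert u A) \<longleftrightarrow> aligned_set A \<and> (\<forall>a\<in>A. aligned a u)"
  by (auto simp: aligned_set_def aligned_refl intro: aligned_sym)

lemma aligned_set_unique:
  "aligned_set A \<Longrightarrow> a \<in> A \<Longrightarrow> g \<in> G \<Longrightarrow> g a \<in> A \<Longrightarrow> g a = a"
  using aligned_setD aligned_act_self_iff by blast

definition max_aligned :: "'a set \<Rightarrow> 'a set \<Rightarrow> bool" where
  "max_aligned S A \<longleftrightarrow> A \<subseteq> S \<and> aligned_set A \<and> (\<forall>u\<in>S. (\<forall>a\<in>A. aligned a u) \<longrightarrow> u \<in> A)"

lemma max_alignedD: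
  assumes "max_aligned S A"
  shows "A \<subseteq> S" "aligned_set A" "\<And>u. u \<in> S \<Longrightarrow> (\<And>a. a \<in> A \<Longrightarrow> aligned a u) \<Longrightarrow> u \<in> A"
  using assms by (auto simp: max_aligned_def)

lemma ex_max_aligned:
  assumes "F \<subseteq> S" "aligned_set F"
  obtains A where "max_aligned S A" "F \<subseteq> A"
proof -
  let ?\<A> = "{A. F \<subseteq> A \<and> A \<subseteq> S \<and> aligned_set A}"
  have "\<exists>M\<in>?\<A>. \<forall>A\<in>?\<A>. M \<subseteq> A \<longrightarrow> A = M"
  proof (rule subset_Zorn_nonempty)
    fix \<C> assume C: "\<C> \<noteq> {}" "subset.chain ?\<A> \<C>"
    have "aligned a b" if "a \<in> X" "X \<in> \<C>" "b \<in> Y" "Y \<in> \<C>" for a b X Y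
    proof -
      have "X \<subseteq> Y \<or> Y \<subseteq> X" "aligned_set X" "aligned_set Y"
        using C(2) that by (auto simp: subset_chain_def)
      then show ?thesis
        using that by (blast dest: aligned_setD)
    qed
    then have "aligned_set (\<Union>\<C>)"
      by (auto simp: aligned_set_def)
    then show "\<Union>\<C> \<in> ?\<A>"
      using C unfolding subset_chain_def by blast
  qed (use assms in auto)
  then obtain M where M: "M \<in> ?\<A>" and maximal: "\<forall>A\<in>?\<A>. M \<subseteq> A \<longrightarrow> A = M" ..
  have "u \<in> M" if "u \<in> S" "\<forall>a\<in>M. aligned a u" for u
  proof -
    have "insert u M \<in> ?\<A>"
      using M that by (auto simp: aligned_set_insert)
    then have "insert u M = M"
      using maximal by blast
    then show ?thesis
      by blast
  qed
  then have "max_aligned S M"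
    using M by (simp add: max_aligned_def)
  then show thesis
    using that M by blast
qed

lemma tangent_space_orb_orthogonal:
  assumes "aligned x y" "v \<in> tangent_space (orb G x) x"
  shows "orthogonal v y"
proof -
  obtain \<gamma> :: "real \<Rightarrow> 'a" where \<gamma>: "\<And>t. \<gamma> t \<in> orb G x" "\<gamma> 0 = x" "(\<gamma> has_vector_derivative v) (at 0)"
    using assms(2) by (auto simp: tangent_space_def)
  have "((\<lambda>t. \<gamma> t \<bullet> y) has_real_derivative v \<bullet> y) (at 0)"
    using bounded_linear.has_vector_derivative[OF bounded_linear_inner_left \<gamma>(3)]
    by (simp add: has_real_derivative_iff_has_vector_derivative)
  moreover have "\<gamma> t \<bullet> y \<le> \<gamma> 0 \<bullet> y" for t
    using \<gamma>(1)[of t] assms(1) by (auto simp: orb_def aligned_def \<gamma>(2))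
  ultimately show ?thesis
    using DERIV_local_max[of "\<lambda>t. \<gamma> t \<bullet> y" _ 0 1] by (simp add: orthogonal_def)
qed

definition max_filter :: "'a \<Rightarrow> 'a \<Rightarrow> real" where
  "max_filter x y = maxfilt (orb G x) (orb G y)"

lemma max_filter_act:
  "g \<in> G \<Longrightarrow> max_filter (g x) y = max_filter x y"
  "g \<in> G \<Longrightarrow> max_filter x (g y) = max_filter x y"
  by (simp_all add: max_filter_def orb_act)

lemma max_filter_commute: "max_filter x y = max_filter y x"
  unfolding max_filter_def maxfilt_def by (rule arg_cong[where f = Sup]) (use inner_commute in blast)

lemma max_filter_aligned:
  assumes "aligned x y"
  shows "max_filter x y = x \<bullet> y"
  unfolding max_filter_def maxfilt_def
proof (rule cSup_eq_maximum)
  show "x \<bullet> y \<in> {p \<bullet> q |p q. p \<in> orb G x \<and> q \<in> orb G y}"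
    using orb_self by blast
qed (auto simp: orb_def intro: aligned_act_le[OF assms])

end

locale orthogonal_action = orthogonal_group +
  fixes S :: "'a set"
  assumes subspace_S: "subspace S"
    and act_in_S: "g \<in> G \<Longrightarrow> x \<in> S \<Longrightarrow> g x \<in> S"
begin

abbreviation restrictions :: "('a \<Rightarrow> 'a) set" where
  "restrictions \<equiv> (\<lambda>g. restrict g S) ` G"

definition induces :: "('a \<Rightarrow> 'a) \<Rightarrow> bool" where
  "induces f \<longleftrightarrow> (\<exists>g\<in>G. \<forall>x\<in>S. g x = f x)"

lemma restrict_mem_restrictions_iff: "restrict f S \<in> restrictions \<longleftrightarrow> induces f"
  by (auto simp: induces_def image_iff restrict_def fun_eq_iff) metis+

lemma induces_comp:
  assumes "induces f" "induces f'"
  shows "induces (f \<circ> f')"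
proof -
  obtain g h where "g \<in> G" "\<forall>x\<in>S. g x = f x" "h \<in> G" "\<forall>x\<in>S. h x = f' x"
    using assms unfolding induces_def by blast
  then show ?thesis
    unfolding induces_def using act_in_S[of h] by (intro bexI[of _ "g \<circ> h"]) (auto simp: comp_mem)
qed

lemma induces_id: "induces id"
  unfolding induces_def by (intro bexI[of _ id] id_mem) simp

lemma induces_refl_word:
  assumes "vs \<in> lists N" "\<And>v. v \<in> N \<Longrightarrow> induces (hrefl v)"
  shows "induces (refl_word vs)"
  using assms(1)
proof induction
  case Nil
  show ?case
    unfolding foldr.simps by (rule induces_id)
next
  case (Cons v vs)
  show ?case
    unfolding foldr.simps using induces_comp[OF assms(2)[OF Cons.hyps(1)] Cons.IH] .
qed

end

lemma (in orthogonal_group) orthogonal_action_weyl: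
  assumes "subspace S"
  shows "orthogonal_action (weyl G S) S"
  using assms by unfold_locales (auto simp: weyl_def orth_group_weyl[unfolded weyl_def])

subsection \<open>Finite reflection groups\<close>

lemma ex_regular_vector:
  assumes "finite (\<Phi> :: 'a::euclidean_space set)" "0 \<notin> \<Phi>"
  shows "\<exists>\<rho>. \<forall>a\<in>\<Phi>. \<rho> \<bullet> a \<noteq> 0"
proof (rule ccontr)
  assume "\<not> ?thesis"
  then have "UNIV \<subseteq> (\<Union>a\<in>\<Phi>. {x. a \<bullet> x = 0})"
    by (auto simp: inner_commute)
  moreover have "negligible (\<Union>a\<in>\<Phi>. {x. a \<bullet> x = 0})"
    using assms by (intro negligible_Union) (auto intro!: negligible_hyperplane)
  ultimately show False
    using negligible_subset by (metis non_negligible_UNIV)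
qed

lemma (in orthogonal_action) finite_reflection_group_onI:
  assumes "finite restrictions" and N: "N \<subseteq> S" "0 \<notin> N"
    and reflections: "\<And>v. v \<in> N \<Longrightarrow> induces (hrefl v)"
    and generated: "\<And>g. g \<in> G \<Longrightarrow> \<exists>vs\<in>lists N. \<forall>x\<in>S. g x = refl_word vs x"
  shows "finite_reflection_group_on S restrictions"
proof -
  have "restrictions = generated_on S ((\<lambda>v. restrict (hrefl v) S) ` N)"
    unfolding generated_on_hrefl[OF subspace_S N(1)]
  proof
    show "restrictions \<subseteq> (\<lambda>vs. restrict (refl_word vs) S) ` lists N"
      using generated by (force intro!: restrict_ext)
    show "(\<lambda>vs. restrict (refl_word vs) S) ` lists N \<subseteq> restrictions"
      using induces_refl_word[OF _ reflections]
      by (simp add: image_subset_iff restrict_mem_restrictions_iff)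
  qed
  moreover have "is_reflection_on S (restrict (hrefl v) S)" if "v \<in> N" for v
    unfolding is_reflection_on_def hrefl_def[abs_def] using that N by (intro bexI[of _ v]) auto
  ultimately show ?thesis
    using assms(1) unfolding finite_reflection_group_on_def
    by (intro conjI exI[of _ "(\<lambda>v. restrict (hrefl v) S) ` N"]) auto
qed

locale finite_reflection_action = orthogonal_action +
  assumes finite_reflection_group: "finite_reflection_group_on S restrictions"
begin

definition roots :: "'a set" where
  "roots = {v \<in> S. norm v = 1 \<and> induces (hrefl v)}"

lemma finite_roots: "finite roots"
proof -
  let ?U = "S \<inter> sphere 0 1"
  have fibre: "finite ((\<lambda>v. restrict (hrefl v) S) -` {r} \<inter> ?U)" for r
  proof (cases "(\<lambda>v. restrict (hrefl v) S) -` {r} \<inter> ?U = {}")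
    case False
    then obtain w where w: "w \<in> ?U" "restrict (hrefl w) S = r"
      by blast
    have "v = w \<or> v = - w" if "v \<in> ?U" "restrict (hrefl v) S = r" for v
    proof -
      have "restrict (hrefl v) S w = restrict (hrefl w) S w"
        by (simp only: w(2) that(2))
      then have "hrefl v w = hrefl w w"
        using w(1) by simp
      then show ?thesis
        using unit_eq_if_hrefl_eq_uminus[of v w] w(1) that(1) by auto
    qed
    then have "(\<lambda>v. restrict (hrefl v) S) -` {r} \<inter> ?U \<subseteq> {w, - w}"
      by blast
    then show ?thesis
      by (rule finite_subset) simp
  qed (simp only: finite.emptyI)
  have "finite restrictions"
    using finite_reflection_group by (simp only: finite_reflection_group_on_def)
  then have "finite ((\<lambda>v. restrict (hrefl v) S) -` restrictions \<inter> ?U)"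
    using fibre by (rule finite_finite_vimage_IntI)
  then show ?thesis
    by (rule rev_finite_subset) (simp add: subset_iff roots_def restrict_mem_restrictions_iff)
qed

lemma induces_root_word: "vs \<in> lists roots \<Longrightarrow> induces (refl_word vs)"
  by (erule induces_refl_word) (simp add: roots_def)

lemma hrefl_root:
  assumes "a \<in> roots" "b \<in> roots"
  shows "hrefl a b \<in> roots"
proof -
  have "induces (refl_word [a, b, a])"
    using assms by (intro induces_root_word) simp
  then show ?thesis
    using assms subspace_S by (auto simp: roots_def hrefl_in_subspace hrefl_hrefl_root comp_assoc)
qed

lemma act_eq_root_word:
  assumes "g \<in> G"
  obtains vs where "vs \<in> lists roots" "\<And>x. x \<in> S \<Longrightarrow> g x = refl_word vs x"
proof -
  obtain T where T: "\<And>r. r \<in> T \<Longrightarrow> is_reflection_on S r" and gen: "restrictions = generated_on S T"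
    using finite_reflection_group unfolding finite_reflection_group_on_def by blast
  define N where "N = {v \<in> S. norm v = 1 \<and> restrict (hrefl v) S \<in> T}"
  have "T = (\<lambda>v. restrict (hrefl v) S) ` N"
    using T by (auto simp: N_def is_reflection_on_iff[OF subspace_S])
  moreover have "N \<subseteq> S"
    by (auto simp: N_def)
  ultimately have words: "restrictions = (\<lambda>vs. restrict (refl_word vs) S) ` lists N"
    using gen generated_on_hrefl[OF subspace_S] by simp
  have "N \<subseteq> roots"
  proof
    fix v assume v: "v \<in> N"
    have "restrict (refl_word [v]) S \<in> restrictions"
      unfolding words using v by (intro imageI) simp
    then show "v \<in> roots"
      using v by (simp add: restrict_mem_restrictions_iff roots_def N_def)
  qed
  moreover have "restrict g S \<in> (\<lambda>vs. restrict (refl_word vs) S) ` lists N"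
    unfolding words[symmetric] using assms by (rule imageI)
  then obtain vs where vs: "restrict g S = restrict (refl_word vs) S" "vs \<in> lists N"
    by (rule imageE)
  moreover have "g x = refl_word vs x" if "x \<in> S" for x
    using fun_cong[OF vs(1), of x] that by simp
  ultimately show thesis
    using that lists_mono by blast
qed

lemma ex_aligned_transversal:
  obtains C where "aligned_set C" "\<And>x. x \<in> S \<Longrightarrow> \<exists>g\<in>G. g x \<in> C"
proof -
  have "0 \<notin> roots"
    by (simp add: roots_def)
  then obtain \<rho> where \<rho>: "\<And>a. a \<in> roots \<Longrightarrow> \<rho> \<bullet> a \<noteq> 0"
    using ex_regular_vector[OF finite_roots] by blast
  interpret root_set roots \<rho>
    by unfold_locales (use finite_roots hrefl_root \<rho> in \<open>auto simp: roots_def\<close>)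
  have "aligned x y" if "x \<in> chamber \<inter> S" "y \<in> chamber \<inter> S" for x y
  proof -
    have "x \<bullet> g y \<le> x \<bullet> y" if "g \<in> G" for g
    proof -
      obtain vs where "vs \<in> lists roots" "\<And>z. z \<in> S \<Longrightarrow> g z = refl_word vs z"
        using act_eq_root_word[OF \<open>g \<in> G\<close>] by blast
      then show ?thesis
        using chamber_word_inner_le \<open>x \<in> chamber \<inter> S\<close> \<open>y \<in> chamber \<inter> S\<close> by auto
    qed
    then have "aligned y x"
      by (simp add: aligned_def inner_commute)
    then show ?thesis
      by (rule aligned_sym)
  qed
  then have "aligned_set (chamber \<inter> S)"
    by (simp add: aligned_set_def)
  moreover have "\<exists>g\<in>G. g x \<in> chamber \<inter> S" if "x \<in> S" for x
  proof -
    obtain vs where vs: "vs \<in> lists roots" "refl_word vs x \<in> chamber"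
      using ex_word_in_chamber by blast
    obtain g where "g \<in> G" "\<forall>x\<in>S. g x = refl_word vs x"
      using induces_root_word[OF vs(1)] unfolding induces_def by blast
    then show ?thesis
      using act_in_S[of g x] vs(2) \<open>x \<in> S\<close> by (intro bexI[of _ g]) auto
  qed
  ultimately show thesis
    by (rule that)
qed

lemma ex_quotient_embedding:
  "\<exists>\<phi> :: 'a set \<Rightarrow> 'a. \<forall>X\<in>orb G ` S. \<forall>Y\<in>orb G ` S. qdist X Y = dist (\<phi> X) (\<phi> Y)"
proof -
  obtain C where C: "aligned_set C" "\<And>x. x \<in> S \<Longrightarrow> \<exists>g\<in>G. g x \<in> C"
    by (rule ex_aligned_transversal) blast
  have "\<exists>c\<in>C. X = orb G c" if "X \<in> orb G ` S" for X
    using C(2) orb_act that by (metis imageE)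
  then obtain \<phi> where \<phi>: "\<And>X. X \<in> orb G ` S \<Longrightarrow> \<phi> X \<in> C \<and> X = orb G (\<phi> X)"
    by metis
  have "qdist X Y = dist (\<phi> X) (\<phi> Y)" if "X \<in> orb G ` S" "Y \<in> orb G ` S" for X Y
    using qdist_orb_aligned[of "\<phi> X" "\<phi> Y"] aligned_setD[OF C(1)] \<phi>[OF that(1)] \<phi>[OF that(2)] by simp
  then show ?thesis
    by blast
qed

end

lemma (in orthogonal_group) finite_reflection_action_weyl:
  assumes "subspace S" "finite_reflection_group_on S ((\<lambda>g. restrict g S) ` weyl G S)"
  shows "finite_reflection_action (weyl G S) S"
  unfolding finite_reflection_action_def finite_reflection_action_axioms_def
  using assms by (simp add: orthogonal_action_weyl)

subsection \<open>Orbits of compact groups of isometries\<close>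

abbreviation dist_id :: "('a::real_normed_vector \<Rightarrow>\<^sub>L 'a) \<Rightarrow> real" where
  "dist_id h \<equiv> norm (h - id_blinfun)"

definition blinfun_power :: "('a::real_normed_vector \<Rightarrow>\<^sub>L 'a) \<Rightarrow> nat \<Rightarrow> ('a \<Rightarrow>\<^sub>L 'a)" where
  "blinfun_power h n = ((o\<^sub>L) h ^^ n) id_blinfun"

lemma blinfun_power_simps [simp]:
  "blinfun_power h 0 = id_blinfun" "blinfun_power h (Suc n) = h o\<^sub>L blinfun_power h n"
  by (simp_all add: blinfun_power_def)

lemma norm_blinfun_power_diff_id:
  assumes "norm h \<le> 1"
  shows "dist_id (blinfun_power h n) \<le> real n * dist_id h"
proof (induction n)
  case (Suc n)
  have "blinfun_power h (Suc n) - id_blinfun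
      = (h o\<^sub>L (blinfun_power h n - id_blinfun)) + (h - id_blinfun)"
    by (rule blinfun_eqI) (simp add: blinfun.bilinear_simps)
  then have "dist_id (blinfun_power h (Suc n))
      \<le> norm (h o\<^sub>L (blinfun_power h n - id_blinfun)) + dist_id h"
    by (metis norm_triangle_ineq)
  also have "\<dots> \<le> norm h * dist_id (blinfun_power h n) + dist_id h"
    by (simp add: norm_blinfun_compose)
  also have "\<dots> \<le> dist_id (blinfun_power h n) + dist_id h"
    using assms by (simp add: mult_left_le_one_le)
  finally show ?case
    using Suc by (simp add: algebra_simps)
qed simp

lemma norm_blinfun_power_linearization:
  assumes "norm h \<le> 1"
  shows "norm (blinfun_power h n - id_blinfun - real n *\<^sub>R (h - id_blinfun)) \<le> (real n * dist_id h)\<^sup>2"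
proof (induction n)
  case (Suc n)
  let ?X = "h - id_blinfun" and ?P = "blinfun_power h n - id_blinfun"
  have "blinfun_power h (Suc n) - id_blinfun - real (Suc n) *\<^sub>R ?X = (?X o\<^sub>L ?P) + (?P - real n *\<^sub>R ?X)"
    by (rule blinfun_eqI) (simp add: blinfun.bilinear_simps algebra_simps)
  then have "norm (blinfun_power h (Suc n) - id_blinfun - real (Suc n) *\<^sub>R ?X)
      \<le> norm (?X o\<^sub>L ?P) + norm (?P - real n *\<^sub>R ?X)"
    by (metis norm_triangle_ineq)
  also have "norm (?X o\<^sub>L ?P) \<le> norm ?X * norm ?P"
    by (rule norm_blinfun_compose)
  also have "\<dots> \<le> norm ?X * (real n * norm ?X)"
    by (intro mult_left_mono norm_blinfun_power_diff_id assms norm_ge_zero)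
  also note Suc
  also have "norm ?X * (real n * norm ?X) + (real n * norm ?X)\<^sup>2 \<le> (real (Suc n) * norm ?X)\<^sup>2"
    by (simp add: power2_eq_square algebra_simps)
  finally show ?case
    by simp
qed simp

lemma norm_blinfun_power_move:
  fixes h :: "'a::real_normed_vector \<Rightarrow>\<^sub>L 'a"
  assumes "norm h \<le> 1"
  shows "norm (blinfun_power h n y - y) \<le> real n * norm (h y - y)"
proof (induction n)
  case (Suc n)
  have "norm (h (blinfun_power h n y - y)) \<le> norm (blinfun_power h n y - y)"
    using norm_blinfun[of h] mult_left_le_one_le[OF norm_ge_zero norm_ge_zero assms]
    by (rule order_trans)
  moreover have "blinfun_power h (Suc n) y - y = h (blinfun_power h n y - y) + (h y - y)"
    by (simp add: blinfun.diff_right)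
  ultimately show ?case
    using Suc norm_triangle_ineq[of "h (blinfun_power h n y - y)" "h y - y"]
    by (simp add: algebra_simps)
qed simp

lemma norm_limit_power_diff_le:
  fixes h :: "nat \<Rightarrow> 'a::real_normed_vector \<Rightarrow>\<^sub>L 'a"
  assumes "\<And>n. norm (h n) \<le> 1" "\<And>n. real (m n) * dist_id (h n) \<le> \<epsilon>"
    and X: "(\<lambda>n. real (m n) *\<^sub>R (h n - id_blinfun)) \<longlonglongrightarrow> X"
    and E: "(\<lambda>n. blinfun_power (h n) (m n)) \<longlonglongrightarrow> E"
  shows "norm (E - id_blinfun - X) \<le> \<epsilon>\<^sup>2"
proof (rule tendsto_upperbound)
  show "(\<lambda>n. norm (blinfun_power (h n) (m n) - id_blinfun - real (m n) *\<^sub>R (h n - id_blinfun)))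
      \<longlonglongrightarrow> norm (E - id_blinfun - X)"
    by (intro tendsto_norm tendsto_diff E X tendsto_const)
  have "norm (blinfun_power (h n) (m n) - id_blinfun - real (m n) *\<^sub>R (h n - id_blinfun)) \<le> \<epsilon>\<^sup>2" for n
    using norm_blinfun_power_linearization[OF assms(1)] power_mono[OF assms(2)]
    by (rule order_trans) simp
  then show "\<forall>\<^sub>F n in sequentially.
      norm (blinfun_power (h n) (m n) - id_blinfun - real (m n) *\<^sub>R (h n - id_blinfun)) \<le> \<epsilon>\<^sup>2"
    by simp
qed simp

lemma limit_power_fixes:
  fixes h :: "nat \<Rightarrow> 'a::real_normed_vector \<Rightarrow>\<^sub>L 'a"
  assumes "\<And>n. norm (h n) \<le> 1" "(\<lambda>n. real (m n) * norm (h n y - y)) \<longlonglongrightarrow> 0"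
    and E: "(\<lambda>n. blinfun_power (h n) (m n)) \<longlonglongrightarrow> E"
  shows "E y = y"
proof -
  have "(\<lambda>n. blinfun_power (h n) (m n) y - y) \<longlonglongrightarrow> 0"
    using assms(2) by (rule Lim_null_comparison[rotated]) (simp add: norm_blinfun_power_move assms(1))
  moreover have "(\<lambda>n. blinfun_power (h n) (m n) y - y) \<longlonglongrightarrow> E y - y"
    by (intro tendsto_diff blinfun.tendsto E tendsto_const)
  ultimately show ?thesis
    using LIMSEQ_unique by fastforce
qed

lemma ex_multiples_tendsto:
  fixes d :: "nat \<Rightarrow> real"
  assumes "\<And>n. 0 < d n" "d \<longlonglongrightarrow> 0" "0 \<le> \<epsilon>"
  obtains m :: "nat \<Rightarrow> nat" where "\<And>n. real (m n) * d n \<le> \<epsilon>" "(\<lambda>n. real (m n) * d n) \<longlonglongrightarrow> \<epsilon>"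
proof
  define m where "m n = nat \<lfloor>\<epsilon> / d n\<rfloor>" for n
  have bounds: "real (m n) * d n \<le> \<epsilon> \<and> \<epsilon> - d n \<le> real (m n) * d n" for n
  proof -
    have "real (m n) = of_int \<lfloor>\<epsilon> / d n\<rfloor>"
      using assms(1)[of n] assms(3) by (simp add: m_def)
    then have "real (m n) \<le> \<epsilon> / d n" "\<epsilon> / d n \<le> real (m n) + 1"
      by linarith+
    then show ?thesis
      using assms(1)[of n] by (simp add: pos_le_divide_eq pos_divide_le_eq distrib_right)
  qed
  then show "real (m n) * d n \<le> \<epsilon>" for n
    by blast
  show "(\<lambda>n. real (m n) * d n) \<longlonglongrightarrow> \<epsilon>"
  proof (rule tendsto_sandwich)
    show "(\<lambda>n. \<epsilon> - d n) \<longlonglongrightarrow> \<epsilon>"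
      using tendsto_diff[OF tendsto_const assms(2), of \<epsilon>] by simp
  qed (use bounds in auto)
qed

lemma ex_multiples_tendsto_direction:
  fixes x :: "nat \<Rightarrow> 'a::real_normed_vector"
  assumes "\<And>n. x n \<noteq> 0" "(\<lambda>n. norm (x n)) \<longlonglongrightarrow> 0" "(\<lambda>n. sgn (x n)) \<longlonglongrightarrow> l" "0 \<le> \<epsilon>"
  obtains m :: "nat \<Rightarrow> nat" where "\<And>n. real (m n) * norm (x n) \<le> \<epsilon>"
    "(\<lambda>n. real (m n) *\<^sub>R x n) \<longlonglongrightarrow> \<epsilon> *\<^sub>R l"
proof -
  obtain m :: "nat \<Rightarrow> nat" where m: "\<And>n. real (m n) * norm (x n) \<le> \<epsilon>" "(\<lambda>n. real (m n) * norm (x n)) \<longlonglongrightarrow> \<epsilon>"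
    using ex_multiples_tendsto[OF _ assms(2,4)] assms(1) by (metis zero_less_norm_iff)
  have "(\<lambda>n. (real (m n) * norm (x n)) *\<^sub>R sgn (x n)) \<longlonglongrightarrow> \<epsilon> *\<^sub>R l"
    by (intro tendsto_scaleR m(2) assms(3))
  also have "(\<lambda>n. (real (m n) * norm (x n)) *\<^sub>R sgn (x n)) = (\<lambda>n. real (m n) *\<^sub>R x n)"
    using assms(1) by (simp add: sgn_div_norm mult.assoc)
  finally show thesis
    by (rule that[OF m(1)])
qed

locale compact_isometry_group =
  fixes H :: "('a::euclidean_space \<Rightarrow>\<^sub>L 'a) set"
  assumes compact_H: "compact H"
    and id_mem: "id_blinfun \<in> H"
    and compose_mem: "h \<in> H \<Longrightarrow> k \<in> H \<Longrightarrow> h o\<^sub>L k \<in> H"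
    and ex_inverse: "h \<in> H \<Longrightarrow> \<exists>k\<in>H. h o\<^sub>L k = id_blinfun \<and> k o\<^sub>L h = id_blinfun"
    and norm_apply: "h \<in> H \<Longrightarrow> norm (h x) = norm x"
begin

lemma norm_le_1: "h \<in> H \<Longrightarrow> norm h \<le> 1"
  by (rule norm_blinfun_bound) (simp_all add: norm_apply)

lemma power_mem: "h \<in> H \<Longrightarrow> blinfun_power h n \<in> H"
  by (induction n) (simp_all add: id_mem compose_mem)

definition minimal_lift :: "'a \<Rightarrow> ('a \<Rightarrow>\<^sub>L 'a) \<Rightarrow> bool" where
  "minimal_lift y h \<longleftrightarrow> h \<in> H \<and> (\<forall>k\<in>H. blinfun_apply k y = blinfun_apply h y \<longrightarrow> dist_id h \<le> dist_id k)"

lemma ex_minimal_lift: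
  assumes "h \<in> H"
  obtains k where "minimal_lift y k" "blinfun_apply k y = blinfun_apply h y"
proof -
  let ?F = "H \<inter> {k. blinfun_apply k y = blinfun_apply h y}"
  have "closed {k. blinfun_apply k y = blinfun_apply h y}"
    by (intro closed_Collect_eq continuous_intros)
  then have "compact ?F"
    using compact_H by (rule compact_Int_closed[rotated])
  moreover have "?F \<noteq> {}"
    using assms by blast
  moreover have "continuous_on ?F (\<lambda>k. dist_id k)"
    by (intro continuous_intros)
  ultimately obtain k where "k \<in> ?F" "\<And>l. l \<in> ?F \<Longrightarrow> dist_id k \<le> dist_id l"
    using continuous_attains_inf[of ?F "\<lambda>k. dist_id k"] by blast
  then show thesis
    by (intro that[of k]) (auto simp: minimal_lift_def)
qed

lemma minimal_lift_le:
  assumes "minimal_lift y h" "u \<in> H" "blinfun_apply u y = y"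
  shows "dist_id h \<le> norm (h - u)"
proof -
  obtain v where v: "v \<in> H" "u o\<^sub>L v = id_blinfun" "v o\<^sub>L u = id_blinfun"
    using ex_inverse assms(2) by blast
  have "v y = y"
    using v(3) assms(3) by (metis blinfun_apply_blinfun_compose blinfun_apply_id_blinfun)
  then have "dist_id h \<le> dist_id (h o\<^sub>L v)"
    using assms(1) compose_mem v(1) by (auto simp: minimal_lift_def)
  also have "(h o\<^sub>L v) - id_blinfun = (h - u) o\<^sub>L v"
    by (rule blinfun_eqI) (simp add: blinfun.diff_left flip: v(2))
  also have "norm ((h - u) o\<^sub>L v) \<le> norm (h - u) * norm v"
    by (rule norm_blinfun_compose)
  also have "\<dots> \<le> norm (h - u)"
    using norm_le_1[OF v(1)] by (simp add: mult_left_le)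
  finally show ?thesis .
qed

lemma ex_fixing_near_tangent:
  fixes h :: "nat \<Rightarrow> 'a \<Rightarrow>\<^sub>L 'a"
  assumes h: "\<And>n. h n \<in> H" "\<And>n. h n \<noteq> id_blinfun" "(\<lambda>n. dist_id (h n)) \<longlonglongrightarrow> 0"
    and X: "(\<lambda>n. sgn (h n - id_blinfun)) \<longlonglongrightarrow> X"
    and slow: "(\<lambda>n. norm (h n y - y) / dist_id (h n)) \<longlonglongrightarrow> 0"
    and "0 \<le> \<epsilon>"
  obtains E where "E \<in> H" "blinfun_apply E y = y" "norm (E - id_blinfun - \<epsilon> *\<^sub>R X) \<le> \<epsilon>\<^sup>2"
proof -
  obtain m :: "nat \<Rightarrow> nat" where m: "\<And>n. real (m n) * dist_id (h n) \<le> \<epsilon>"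
    and linear_part: "(\<lambda>n. real (m n) *\<^sub>R (h n - id_blinfun)) \<longlonglongrightarrow> \<epsilon> *\<^sub>R X"
    using ex_multiples_tendsto_direction[OF _ h(3) X \<open>0 \<le> \<epsilon>\<close>] h(2) by auto
  have "real (m n) * norm (h n y - y) \<le> \<epsilon> * (norm (h n y - y) / dist_id (h n))" for n
    using mult_right_mono[OF m[of n], of "norm (h n y - y) / dist_id (h n)"] h(2)[of n] by simp
  then have move: "(\<lambda>n. real (m n) * norm (h n y - y)) \<longlonglongrightarrow> 0"
    by (intro Lim_null_comparison[OF _ tendsto_mult_right_zero[OF slow, of \<epsilon>]]) simp
  have "\<forall>n. blinfun_power (h n) (m n) \<in> H"
    using power_mem h(1) by blast
  with compact_imp_seq_compact[OF compact_H] obtain E r where E: "E \<in> H" and r: "strict_mono r"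
    and "((\<lambda>n. blinfun_power (h n) (m n)) \<circ> r) \<longlonglongrightarrow> E"
    by (rule seq_compactE)
  then have lim: "(\<lambda>n. blinfun_power (h (r n)) (m (r n))) \<longlonglongrightarrow> E"
    by (simp add: o_def)
  show thesis
  proof (rule that[OF E])
    show "blinfun_apply E y = y"
      using LIMSEQ_subseq_LIMSEQ[OF move r]
      by (intro limit_power_fixes[OF _ _ lim]) (simp_all add: norm_le_1 h(1) o_def)
    show "norm (E - id_blinfun - \<epsilon> *\<^sub>R X) \<le> \<epsilon>\<^sup>2"
      using LIMSEQ_subseq_LIMSEQ[OF linear_part r] m
      by (intro norm_limit_power_diff_le[OF _ _ _ lim]) (simp_all add: norm_le_1 h(1) o_def)
  qed
qed

text \<open>A limit of powers of the \<open>h n\<close> fixes \<open>y\<close> and is close to one of the \<open>h n\<close>.\<close>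

lemma minimal_lift_not_slow:
  fixes h :: "nat \<Rightarrow> 'a \<Rightarrow>\<^sub>L 'a"
  assumes h: "\<And>n. minimal_lift y (h n)" "\<And>n. h n \<noteq> id_blinfun" "(\<lambda>n. dist_id (h n)) \<longlonglongrightarrow> 0"
    and X: "(\<lambda>n. sgn (h n - id_blinfun)) \<longlonglongrightarrow> X"
  shows "\<not> (\<lambda>n. norm (h n y - y) / dist_id (h n)) \<longlonglongrightarrow> 0"
proof
  assume slow: "(\<lambda>n. norm (h n y - y) / dist_id (h n)) \<longlonglongrightarrow> 0"
  have "(\<lambda>n. norm (sgn (h n - id_blinfun) - X) + dist_id (h n)) \<longlonglongrightarrow> 0 + 0"
    by (intro tendsto_add tendsto_norm_zero LIM_zero X h(3))
  then have "\<forall>\<^sub>F n in sequentially. norm (sgn (h n - id_blinfun) - X) + dist_id (h n) < 1"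
    by (intro order_tendstoD(2)) auto
  then obtain n where n: "norm (sgn (h n - id_blinfun) - X) + dist_id (h n) < 1"
    using eventually_happens'[OF sequentially_bot] by blast
  define \<epsilon> where "\<epsilon> = dist_id (h n)"
  have \<epsilon>: "0 < \<epsilon>"
    using h(2) by (simp add: \<epsilon>_def)
  obtain E where E: "E \<in> H" "blinfun_apply E y = y" "norm (E - id_blinfun - \<epsilon> *\<^sub>R X) \<le> \<epsilon>\<^sup>2"
    using ex_fixing_near_tangent[OF _ h(2,3) X slow less_imp_le[OF \<epsilon>]] h(1)
    by (auto simp: minimal_lift_def)
  have "norm (h n - E) = norm (\<epsilon> *\<^sub>R (sgn (h n - id_blinfun) - X) - (E - id_blinfun - \<epsilon> *\<^sub>R X))"
    using \<epsilon> by (simp add: \<epsilon>_def sgn_div_norm scaleR_diff_right)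
  also have "\<dots> \<le> \<epsilon> * norm (sgn (h n - id_blinfun) - X) + \<epsilon>\<^sup>2"
    by (rule order_trans[OF norm_triangle_ineq4]) (use E(3) \<epsilon> in simp)
  also have "\<dots> = \<epsilon> * (norm (sgn (h n - id_blinfun) - X) + \<epsilon>)"
    by (simp add: distrib_left power2_eq_square)
  also have "\<dots> < \<epsilon>"
    using n \<epsilon> by (simp add: \<epsilon>_def)
  finally show False
    using minimal_lift_le[OF h(1) E(1,2), of n] by (simp add: \<epsilon>_def)
qed

lemma minimal_lift_subsequence:
  fixes g :: "nat \<Rightarrow> 'a \<Rightarrow>\<^sub>L 'a"
  assumes g: "\<And>n. minimal_lift y (g n)" and lim_fix: "(\<lambda>n. g n y) \<longlonglongrightarrow> y"
  obtains r X where "strict_mono r" "(\<lambda>n. dist_id (g (r n))) \<longlonglongrightarrow> 0"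
    "(\<lambda>n. sgn (g (r n) - id_blinfun)) \<longlonglongrightarrow> X"
proof -
  have "\<forall>n. g n \<in> H"
    using g by (simp add: minimal_lift_def)
  with compact_imp_seq_compact[OF compact_H]
  obtain u r where u: "u \<in> H" and r: "strict_mono r" and "(g \<circ> r) \<longlonglongrightarrow> u"
    by (rule seq_compactE)
  then have lim: "(\<lambda>n. g (r n)) \<longlonglongrightarrow> u"
    by (simp add: o_def)
  have "(\<lambda>n. g (r n) y) \<longlonglongrightarrow> u y"
    by (intro blinfun.tendsto lim tendsto_const)
  then have "blinfun_apply u y = y"
    using LIMSEQ_unique LIMSEQ_subseq_LIMSEQ[OF lim_fix r, unfolded o_def] by blast
  have to_id: "(\<lambda>n. dist_id (g (r n))) \<longlonglongrightarrow> 0"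
  proof (rule Lim_null_comparison)
    show "\<forall>\<^sub>F n in sequentially. norm (dist_id (g (r n))) \<le> norm (g (r n) - u)"
      using minimal_lift_le[OF g u \<open>blinfun_apply u y = y\<close>] by simp
    show "(\<lambda>n. norm (g (r n) - u)) \<longlonglongrightarrow> 0"
      by (intro tendsto_norm_zero LIM_zero lim)
  qed
  have "\<forall>n. sgn (g (r n) - id_blinfun) \<in> cball 0 1"
    by (simp add: norm_sgn)
  with compact_imp_seq_compact[OF compact_cball]
  obtain X q where q: "strict_mono q" and X: "((\<lambda>n. sgn (g (r n) - id_blinfun)) \<circ> q) \<longlonglongrightarrow> X"
    by (rule seq_compactE)
  show thesis
    using LIMSEQ_subseq_LIMSEQ[OF to_id q] strict_mono_o[OF r q] X
    by (intro that[of "r \<circ> q" X]) (simp_all add: o_def)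
qed

lemma tendsto_fixed_if_slow:
  fixes g :: "nat \<Rightarrow> 'a \<Rightarrow>\<^sub>L 'a"
  assumes g: "\<And>n. g n \<in> H" "\<And>n. g n \<noteq> id_blinfun"
    and slow: "(\<lambda>n. norm (g n y - y) / dist_id (g n)) \<longlonglongrightarrow> 0"
  shows "(\<lambda>n. g n y) \<longlonglongrightarrow> y"
proof -
  have "norm (g n y - y) \<le> 2 * (norm (g n y - y) / dist_id (g n))" for n
  proof -
    have "dist_id (g n) \<le> 2"
      using norm_triangle_ineq4[of "g n" id_blinfun] norm_le_1[OF g(1)[of n]] norm_le_1[OF id_mem]
      by simp
    then show ?thesis
      using g(2)[of n] mult_right_mono[of "dist_id (g n)" 2 "norm (g n y - y)"]
      by (simp add: field_simps)
  qed
  then have "(\<lambda>n. g n y - y) \<longlonglongrightarrow> 0"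
    by (intro Lim_null_comparison[OF _ tendsto_mult_right_zero[OF slow, of 2]]) simp
  then show ?thesis
    by (rule LIM_zero_cancel)
qed

lemma ex_Lipschitz_lift:
  "\<exists>C. \<forall>h\<in>H. \<exists>k\<in>H. blinfun_apply k y = blinfun_apply h y \<and> dist_id k \<le> C * norm (blinfun_apply h y - y)"
proof (rule ccontr)
  assume no_bound: "\<not> ?thesis"
  have "\<exists>g. minimal_lift y g \<and> real n * norm (g y - y) < dist_id g" for n
  proof -
    obtain h where h: "h \<in> H" "\<And>k. k \<in> H \<Longrightarrow> blinfun_apply k y = blinfun_apply h y \<Longrightarrow>
        \<not> dist_id k \<le> real n * norm (blinfun_apply h y - y)"
      using no_bound by blast
    obtain g where "minimal_lift y g" "blinfun_apply g y = blinfun_apply h y"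
      using ex_minimal_lift[OF h(1)] by blast
    then show ?thesis
      using h(2) by (auto simp: minimal_lift_def not_le)
  qed
  then obtain g where g: "\<And>n. minimal_lift y (g n)"
    and far: "\<And>n. real n * norm (g n y - y) < dist_id (g n)"
    by metis
  have nonid: "g n \<noteq> id_blinfun" for n
    using far[of n] by auto
  have "norm (g n y - y) / dist_id (g n) \<le> 1 / real n" if "0 < n" for n
    using far[of n] nonid[of n] that by (simp add: field_simps)
  then have slow: "(\<lambda>n. norm (g n y - y) / dist_id (g n)) \<longlonglongrightarrow> 0"
    by (intro Lim_null_comparison[OF _ lim_1_over_n] eventually_mono[OF eventually_gt_at_top[of 0]]) simp
  then have "(\<lambda>n. g n y) \<longlonglongrightarrow> y"
    using g nonid by (intro tendsto_fixed_if_slow) (simp_all add: minimal_lift_def)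
  then obtain r X where r: "strict_mono r" and lims: "(\<lambda>n. dist_id (g (r n))) \<longlonglongrightarrow> 0"
    "(\<lambda>n. sgn (g (r n) - id_blinfun)) \<longlonglongrightarrow> X"
    by (rule minimal_lift_subsequence[OF g])
  show False
    using minimal_lift_not_slow[of y "\<lambda>n. g (r n)", OF g nonid lims] LIMSEQ_subseq_LIMSEQ[OF slow r]
    by (simp add: o_def)
qed

end

subsection \<open>Groups with closed orbits\<close>

lemma subspace_dominated:
  fixes f :: "'i \<Rightarrow> 'a::real_vector \<Rightarrow> real"
  assumes linear: "\<And>i. i \<in> I \<Longrightarrow> linear (f i)"
  shows "subspace {x. \<exists>K. \<forall>i\<in>I. \<bar>f i x\<bar> \<le> K * c i}"
proof (rule subspaceI; clarify)
  show "\<exists>K. \<forall>i\<in>I. \<bar>f i 0\<bar> \<le> K * c i"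
    by (intro exI[of _ 0]) (simp add: linear_0[OF linear])
next
  fix x y K L assume "\<forall>i\<in>I. \<bar>f i x\<bar> \<le> K * c i" "\<forall>i\<in>I. \<bar>f i y\<bar> \<le> L * c i"
  then have "\<forall>i\<in>I. \<bar>f i (x + y)\<bar> \<le> (K + L) * c i"
    using abs_triangle_ineq[of "f _ x" "f _ y"] by (force simp: linear_add[OF linear] distrib_right)
  then show "\<exists>K. \<forall>i\<in>I. \<bar>f i (x + y)\<bar> \<le> K * c i" ..
next
  fix r :: real and x K assume "\<forall>i\<in>I. \<bar>f i x\<bar> \<le> K * c i"
  then have "\<forall>i\<in>I. \<bar>f i (r *\<^sub>R x)\<bar> \<le> (\<bar>r\<bar> * K) * c i"
    by (simp add: linear_scale[OF linear] abs_mult mult.assoc mult_left_mono)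
  then show "\<exists>K. \<forall>i\<in>I. \<bar>f i (r *\<^sub>R x)\<bar> \<le> K * c i" ..
qed

locale closed_orbit_group = orthogonal_group +
  assumes closed_orbits: "closed (orb G x)"
begin

lemma compact_orb: "compact (orb G x)"
  unfolding compact_eq_bounded_closed
  using closed_orbits norm_act by (auto simp: orb_def bounded_iff intro!: exI[of _ "norm x"])

lemma ex_aligned_act:
  obtains g where "g \<in> G" "aligned (g x) y"
proof -
  have "continuous_on (orb G x) (\<lambda>p. p \<bullet> y)"
    by (intro continuous_intros)
  then obtain p where p: "p \<in> orb G x" "\<And>q. q \<in> orb G x \<Longrightarrow> q \<bullet> y \<le> p \<bullet> y"
    using continuous_attains_sup[OF compact_orb] orb_self by (metis empty_iff)
  then obtain g where g: "g \<in> G" "p = g x"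
    by (auto simp: orb_def)
  have "aligned (g x) y"
    using p(2) orb_mem[of _ "g x"] unfolding aligned_def orb_act[OF g(1)] g(2) by blast
  then show thesis
    using that g(1) by blast
qed

lemma inner_act_le_max_filter:
  assumes "g \<in> G"
  shows "g x \<bullet> y \<le> max_filter x y"
proof -
  obtain h where h: "h \<in> G" "aligned (h x) y"
    by (rule ex_aligned_act)
  have "(g \<circ> inv h) (h x) \<bullet> y \<le> h x \<bullet> y"
    using h(2) comp_mem[OF assms inv_mem[OF h(1)]] unfolding aligned_def by blast
  then show ?thesis
    using max_filter_aligned[OF h(2)] by (simp add: max_filter_act inv_act h(1))
qed

lemma inner_le_max_filter: "x \<bullet> y \<le> max_filter x y"
  using inner_act_le_max_filter[OF id_mem] by simp

lemma aligned_iff_max_filter: "aligned x y \<longleftrightarrow> max_filter x y = x \<bullet> y"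
  using max_filter_aligned inner_act_le_max_filter unfolding aligned_def by metis

lemma qdist_orb_power2: "(qdist (orb G x) (orb G y))\<^sup>2 = x \<bullet> x + y \<bullet> y - 2 * max_filter x y"
proof -
  obtain g where g: "g \<in> G" "aligned (g x) y"
    by (rule ex_aligned_act)
  then have "qdist (orb G x) (orb G y) = dist (g x) y" "max_filter x y = g x \<bullet> y"
    using qdist_orb_aligned[OF g(2)] max_filter_aligned[OF g(2)]
    by (simp_all add: orb_act max_filter_act)
  then show ?thesis
    by (simp add: dist_power2_eq_inner inner_act g(1))
qed

definition closure_group :: "('a \<Rightarrow>\<^sub>L 'a) set" where
  "closure_group = closure (Blinfun ` G)"

lemma blinfun_apply_Blinfun_act: "g \<in> G \<Longrightarrow> blinfun_apply (Blinfun g) = g"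
  using linear_act linear_conv_bounded_linear bounded_linear_Blinfun_apply by blast

lemma Blinfun_in_closure_group: "g \<in> G \<Longrightarrow> Blinfun g \<in> closure_group"
  unfolding closure_group_def by (rule subsetD[OF closure_subset]) (rule imageI)

lemma closure_group_subsetI: "closed T \<Longrightarrow> (\<And>g. g \<in> G \<Longrightarrow> Blinfun g \<in> T) \<Longrightarrow> closure_group \<subseteq> T"
  unfolding closure_group_def by (rule closure_minimal) auto

lemma closure_group_apply_orb:
  assumes "h \<in> closure_group"
  shows "blinfun_apply h x \<in> orb G x"
proof -
  have "closed ((\<lambda>h. blinfun_apply h x) -` orb G x)"
    by (intro continuous_closed_vimage closed_orbits continuous_intros)
  then have "closure_group \<subseteq> (\<lambda>h. blinfun_apply h x) -` orb G x"
    by (rule closure_group_subsetI) (simp add: blinfun_apply_Blinfun_act orb_mem)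
  then show ?thesis
    using assms by blast
qed

lemma norm_closure_group_apply: "h \<in> closure_group \<Longrightarrow> norm (blinfun_apply h x) = norm x"
  using closure_group_apply_orb[of h x] norm_act by (auto simp: orb_def)

lemma compact_closure_group: "compact closure_group"
proof -
  have "norm h \<le> 1" if "h \<in> closure_group" for h
    using that by (intro norm_blinfun_bound) (simp_all add: norm_closure_group_apply)
  then have "bounded closure_group"
    unfolding bounded_iff by blast
  then show ?thesis
    by (simp add: compact_eq_bounded_closed closure_group_def)
qed

lemma Blinfun_compose_act:
  assumes "g \<in> G" "h \<in> G"
  shows "Blinfun g o\<^sub>L Blinfun h = Blinfun (g \<circ> h)"
  by (rule blinfun_eqI) (simp add: blinfun_apply_Blinfun_act comp_mem assms)

lemma Blinfun_id: "Blinfun id = (id_blinfun :: 'a \<Rightarrow>\<^sub>L 'a)"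
  by (rule blinfun_eqI) (simp add: blinfun_apply_Blinfun_act id_mem)

lemma compose_closure_group:
  assumes "h \<in> closure_group" "k \<in> closure_group"
  shows "h o\<^sub>L k \<in> closure_group"
proof -
  have closed: "closed closure_group"
    by (simp add: closure_group_def)
  have "closure_group \<subseteq> (\<lambda>h. h o\<^sub>L Blinfun g) -` closure_group" if "g \<in> G" for g
    by (rule closure_group_subsetI)
      (auto intro!: continuous_closed_vimage closed continuous_intros
        simp: Blinfun_compose_act that comp_mem Blinfun_in_closure_group)
  then have "closure_group \<subseteq> (\<lambda>k. h o\<^sub>L k) -` closure_group"
    using assms(1)
    by (intro closure_group_subsetI continuous_closed_vimage closed continuous_intros) auto
  then show ?thesis
    using assms(2) by blast
qed

lemma ex_inverse_closure_group:
  assumes "h \<in> closure_group"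
  shows "\<exists>k\<in>closure_group. h o\<^sub>L k = id_blinfun \<and> k o\<^sub>L h = id_blinfun"
proof -
  let ?I = "{(h, k). h o\<^sub>L k = id_blinfun \<and> k o\<^sub>L h = id_blinfun}"
  let ?P = "closure_group \<times> closure_group \<inter> ?I"
  have "closed ?I"
    unfolding case_prod_beta by (intro closed_Collect_conj closed_Collect_eq continuous_intros)
  then have "compact (fst ` ?P)"
    by (intro compact_continuous_image compact_Int_closed compact_Times compact_closure_group
        continuous_intros)
  moreover have "Blinfun g \<in> fst ` ?P" if "g \<in> G" for g
  proof -
    have "g \<circ> inv g = id" "inv g \<circ> g = id"
      using that by (simp_all add: fun_eq_iff act_inv inv_act)
    then show ?thesis
      using that inv_mem[OF that]
      by (intro image_eqI[of _ _ "(Blinfun g, Blinfun (inv g))"])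
        (simp_all add: Blinfun_in_closure_group Blinfun_compose_act Blinfun_id)
  qed
  ultimately have "closure_group \<subseteq> fst ` ?P"
    by (intro closure_group_subsetI compact_imp_closed)
  then have "h \<in> fst ` ?P"
    using assms by (rule subsetD)
  then show ?thesis
    by force
qed

sublocale closure: compact_isometry_group closure_group
  using compact_closure_group compose_closure_group ex_inverse_closure_group norm_closure_group_apply
    Blinfun_in_closure_group[OF id_mem]
  by unfold_locales (simp_all add: Blinfun_id)

lemma aligned_displacement:
  assumes "aligned a b" "h \<in> closure_group"
  shows "\<bar>(blinfun_apply h a - a) \<bullet> b\<bar> \<le> norm a * norm b * (dist_id h)\<^sup>2"
proof -
  have "orthogonal_transformation (blinfun_apply h)"
    unfolding orthogonal_transformation using norm_closure_group_apply[OF assms(2)]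
    by (simp add: blinfun.bounded_linear_right bounded_linear.linear)
  then have isometry: "blinfun_apply h a \<bullet> blinfun_apply h b = a \<bullet> b"
    by (simp add: orthogonal_transformation_def)
  have "blinfun_apply h a \<in> orb G a" "blinfun_apply h b \<in> orb G b"
    using assms(2) by (simp_all add: closure_group_apply_orb)
  then have nonneg: "blinfun_apply h a \<bullet> b \<le> a \<bullet> b" "a \<bullet> blinfun_apply h b \<le> a \<bullet> b"
    using aligned_act_le[OF assms(1) _ id_mem] aligned_act_le[OF assms(1) id_mem]
    by (auto simp: orb_def)
  have move: "norm (blinfun_apply h x - x) \<le> dist_id h * norm x" for x
    using norm_blinfun[of "h - id_blinfun" x] by (simp add: blinfun.diff_left)
  have "(a \<bullet> b - blinfun_apply h a \<bullet> b) + (a \<bullet> b - a \<bullet> blinfun_apply h b)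
      = (blinfun_apply h a - a) \<bullet> (blinfun_apply h b - b)"
    by (simp add: inner_diff_left inner_diff_right isometry)
  also have "\<dots> \<le> norm (blinfun_apply h a - a) * norm (blinfun_apply h b - b)"
    by (rule norm_cauchy_schwarz)
  also have "\<dots> \<le> (dist_id h * norm a) * (dist_id h * norm b)"
    by (intro mult_mono move) auto
  finally have "a \<bullet> b - blinfun_apply h a \<bullet> b \<le> norm a * norm b * (dist_id h)\<^sup>2"
    using nonneg(2) by (simp add: power2_eq_square algebra_simps)
  then show ?thesis
    using nonneg(1) by (simp add: inner_diff_left)
qed

lemma aligned_span_displacement:
  assumes A: "aligned_set A" and y: "y \<in> span A" and z: "z \<in> span A"
  shows "\<exists>K. \<forall>h\<in>closure_group. \<bar>(blinfun_apply h y - y) \<bullet> z\<bar> \<le> K * (dist_id h)\<^sup>2"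
proof -
  define dominated where "dominated u v \<longleftrightarrow>
    (\<exists>K. \<forall>h\<in>closure_group. \<bar>(blinfun_apply h u - u) \<bullet> v\<bar> \<le> K * (dist_id h)\<^sup>2)" for u v
  have "linear (\<lambda>v. (blinfun_apply h u - u) \<bullet> v)" for h u
    by (rule linearI) (simp_all add: inner_add_right)
  then have right: "subspace {v. dominated u v}" for u
    unfolding dominated_def by (rule subspace_dominated)
  have "linear (\<lambda>u. (blinfun_apply h u - u) \<bullet> v)" for h v
    by (rule linearI) (simp_all add: blinfun.bilinear_simps inner_add_left inner_diff_left algebra_simps)
  then have left: "subspace {u. dominated u v}" for v
    unfolding dominated_def by (rule subspace_dominated)
  have "dominated a b" if "a \<in> A" "b \<in> A" for a b
    unfolding dominated_def using aligned_displacement[OF aligned_setD[OF A that]] by blast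
  then have "dominated a z" if "a \<in> A" for a
    using span_induct[OF z right[of a]] that by blast
  then have "dominated y z"
    using span_induct[OF y left[of z]] by blast
  then show ?thesis
    by (simp add: dominated_def)
qed

lemma aligned_span_quadratic:
  assumes "aligned_set A" "y \<in> span A" "z \<in> span A"
  obtains C where "0 < C" "\<And>g. g \<in> G \<Longrightarrow> (g y - y) \<bullet> z \<le> C * (norm (g y - y))\<^sup>2"
proof -
  obtain K where K: "\<And>h. h \<in> closure_group \<Longrightarrow> \<bar>(blinfun_apply h y - y) \<bullet> z\<bar> \<le> K * (dist_id h)\<^sup>2"
    using aligned_span_displacement[OF assms] by blast
  obtain L where L: "\<And>h. h \<in> closure_group \<Longrightarrow> \<exists>k\<in>closure_group. blinfun_apply k y = blinfun_apply h y \<and>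
      dist_id k \<le> L * norm (blinfun_apply h y - y)"
    using closure.ex_Lipschitz_lift[of y] by blast
  have "(g y - y) \<bullet> z \<le> (\<bar>K\<bar> * L\<^sup>2 + 1) * (norm (g y - y))\<^sup>2" if "g \<in> G" for g
  proof -
    obtain k where k: "k \<in> closure_group" "blinfun_apply k y = g y" "dist_id k \<le> L * norm (g y - y)"
      using L[OF Blinfun_in_closure_group] blinfun_apply_Blinfun_act \<open>g \<in> G\<close> by metis
    have "(g y - y) \<bullet> z \<le> \<bar>K\<bar> * (dist_id k)\<^sup>2"
      using K[OF k(1)] mult_right_mono[OF abs_ge_self[of K], of "(dist_id k)\<^sup>2"] by (simp add: k(2))
    also have "\<dots> \<le> \<bar>K\<bar> * (L * norm (g y - y))\<^sup>2"
      using k(3) by (intro mult_left_mono power_mono) auto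
    also have "\<dots> \<le> (\<bar>K\<bar> * L\<^sup>2 + 1) * (norm (g y - y))\<^sup>2"
      by (simp add: power_mult_distrib distrib_right)
    finally show ?thesis .
  qed
  then show thesis
    using that[of "\<bar>K\<bar> * L\<^sup>2 + 1"] by (simp add: add_nonneg_pos)
qed

lemma aligned_small_step:
  assumes "aligned_set A" "y \<in> span A" "z \<in> span A"
  obtains s where "0 < s" "aligned y (y + s *\<^sub>R z)"
proof -
  obtain C where C: "0 < C" "\<And>g. g \<in> G \<Longrightarrow> (g y - y) \<bullet> z \<le> C * (norm (g y - y))\<^sup>2"
    using aligned_span_quadratic[OF assms] by blast
  have "g y \<bullet> (y + (1 / (2 * C)) *\<^sub>R z) \<le> y \<bullet> (y + (1 / (2 * C)) *\<^sub>R z)" if g: "g \<in> G" for g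
  proof -
    have square: "(norm (g y - y))\<^sup>2 = 2 * (y \<bullet> y - g y \<bullet> y)"
      using dist_power2_eq_inner[of "g y" y] by (simp add: dist_norm inner_act g)
    have "(g y - y) \<bullet> z \<le> C * (2 * (y \<bullet> y - g y \<bullet> y))"
      using C(2)[OF g] unfolding square .
    then have "(1 / (2 * C)) * ((g y - y) \<bullet> z) \<le> y \<bullet> y - g y \<bullet> y"
      using C(1) by (simp add: pos_divide_le_eq mult_ac)
    then show ?thesis
      by (simp add: inner_add_right inner_diff_left right_diff_distrib)
  qed
  then show thesis
    using C(1) by (intro that[of "1 / (2 * C)"]) (simp_all add: aligned_def)
qed

end

subsection \<open>Positive definite max filtering\<close>

lemma pd_kernel_on_inner:
  fixes \<psi> :: "'b \<Rightarrow> 'c::real_inner"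
  assumes "\<And>x y. x \<in> X \<Longrightarrow> y \<in> X \<Longrightarrow> K x y = \<psi> x \<bullet> \<psi> y"
  shows "pd_kernel_on X K"
  unfolding pd_kernel_on_def
proof (intro conjI ballI allI impI)
  show "K x y = K y x" if "x \<in> X" "y \<in> X" for x y
    using assms that by (simp add: inner_commute)
  fix n :: nat and x :: "nat \<Rightarrow> 'b" and c :: "nat \<Rightarrow> real"
  assume "\<forall>i<n. x i \<in> X"
  then have "(\<Sum>i<n. \<Sum>j<n. c i * c j * K (x i) (x j))
      = (\<Sum>i<n. \<Sum>j<n. (c i *\<^sub>R \<psi> (x i)) \<bullet> (c j *\<^sub>R \<psi> (x j)))"
    using assms by (intro sum.cong refl) (simp add: mult.assoc)
  also have "\<dots> = (\<Sum>i<n. c i *\<^sub>R \<psi> (x i)) \<bullet> (\<Sum>j<n. c j *\<^sub>R \<psi> (x j))"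
    unfolding inner_sum_left inner_sum_right by (rule sum.swap)
  finally show "0 \<le> (\<Sum>i<n. \<Sum>j<n. c i * c j * K (x i) (x j))"
    by simp
qed

lemma (in closed_orbit_group) pd_kernel_if_isometric_embedding:
  fixes \<psi> :: "'a set \<Rightarrow> 'c::real_inner"
  assumes "\<And>X Y. X \<in> range (orb G) \<Longrightarrow> Y \<in> range (orb G) \<Longrightarrow> qdist X Y = dist (\<psi> X) (\<psi> Y)"
  shows "pd_kernel_on (range (orb G)) maxfilt"
proof (rule pd_kernel_on_inner)
  fix X Y assume "X \<in> range (orb G)" "Y \<in> range (orb G)"
  then obtain x y where xy: "X = orb G x" "Y = orb G y"
    by blast
  define f where "f z = \<psi> (orb G z) - \<psi> (orb G 0)" for z
  have dist: "(dist (f u) (f v))\<^sup>2 = u \<bullet> u + v \<bullet> v - 2 * max_filter u v" for u v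
    using qdist_orb_power2[of u v] assms by (simp add: f_def dist_norm)
  have norm: "f u \<bullet> f u = u \<bullet> u" for u
    using dist[of u 0] max_filter_aligned[OF aligned_zero[of u]] max_filter_commute[of u 0]
    by (simp add: f_def power2_norm_eq_inner)
  have "f x \<bullet> f y = max_filter x y"
    using dist[of x y] by (simp add: dist_power2_eq_inner norm)
  then show "maxfilt X Y = (\<psi> X - \<psi> (orb G 0)) \<bullet> (\<psi> Y - \<psi> (orb G 0))"
    by (simp add: xy f_def max_filter_def)
qed

lemma (in closed_orbit_group) pd_kernel_if_isometric_to_reflection_quotient:
  fixes H :: "('c::euclidean_space \<Rightarrow> 'c) set" and f :: "'a set \<Rightarrow> 'c set"
  assumes "finite_reflection_action H S"
    and f: "f ` range (orb G) \<subseteq> orb H ` S"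
      "\<And>X Y. X \<in> range (orb G) \<Longrightarrow> Y \<in> range (orb G) \<Longrightarrow> qdist (f X) (f Y) = qdist X Y"
  shows "pd_kernel_on (range (orb G)) maxfilt"
proof -
  interpret H: finite_reflection_action H S
    by fact
  obtain \<phi> :: "'c set \<Rightarrow> 'c" where \<phi>: "\<forall>X\<in>orb H ` S. \<forall>Y\<in>orb H ` S. qdist X Y = dist (\<phi> X) (\<phi> Y)"
    using H.ex_quotient_embedding by blast
  have "qdist X Y = dist (\<phi> (f X)) (\<phi> (f Y))" if "X \<in> range (orb G)" "Y \<in> range (orb G)" for X Y
  proof -
    have "f X \<in> orb H ` S" "f Y \<in> orb H ` S"
      using f(1) that by blast+
    then have "qdist (f X) (f Y) = dist (\<phi> (f X)) (\<phi> (f Y))"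
      using \<phi> by blast
    then show ?thesis
      by (simp add: f(2) that)
  qed
  then show ?thesis
    by (rule pd_kernel_if_isometric_embedding)
qed

text \<open>The coefficients \<open>s * c 0, \<dots>, s * c (n - 1), 1\<close> at \<open>x 0, \<dots>, x (n - 1), u\<close> give a quadratic
  form that is affine in \<open>s\<close>.\<close>

lemma pd_kernel_on_null:
  fixes n :: nat
  assumes pd: "pd_kernel_on X K" and x: "\<And>i. i < n \<Longrightarrow> x i \<in> X" and u: "u \<in> X"
    and null: "(\<Sum>i<n. \<Sum>j<n. c i * c j * K (x i) (x j)) = 0"
  shows "(\<Sum>i<n. c i * K (x i) u) = 0"
proof (rule ccontr)
  define L where "L = (\<Sum>i<n. c i * K (x i) u)"
  assume "(\<Sum>i<n. c i * K (x i) u) \<noteq> 0"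
  then have "L \<noteq> 0"
    by (simp add: L_def)
  have affine: "0 \<le> 2 * s * L + K u u" for s :: real
  proof -
    define y b where "y = x(n := u)" and "b = (\<lambda>i. s * c i)(n := 1)"
    have "\<forall>i<Suc n. y i \<in> X"
      using x u by (simp add: y_def)
    then have "0 \<le> (\<Sum>i<Suc n. \<Sum>j<Suc n. b i * b j * K (y i) (y j))"
      using pd unfolding pd_kernel_on_def by blast
    also have "\<dots> = (\<Sum>i<n. \<Sum>j<n. b i * b j * K (y i) (y j)) + (\<Sum>i<n. b i * K (y i) u)
        + (\<Sum>j<n. b j * K u (y j)) + K u u"
      by (simp add: sum.distrib y_def b_def)
    also have "(\<Sum>i<n. \<Sum>j<n. b i * b j * K (y i) (y j)) = s\<^sup>2 * (\<Sum>i<n. \<Sum>j<n. c i * c j * K (x i) (x j))"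
      unfolding sum_distrib_left by (intro sum.cong refl) (simp add: y_def b_def power2_eq_square)
    also have "(\<Sum>i<n. b i * K (y i) u) = s * L"
      unfolding L_def sum_distrib_left by (intro sum.cong refl) (simp add: y_def b_def)
    also have "(\<Sum>j<n. b j * K u (y j)) = s * L"
      unfolding L_def sum_distrib_left
      using pd x u by (intro sum.cong refl) (simp add: y_def b_def pd_kernel_on_def)
    finally show ?thesis
      using null by (simp add: mult_ac)
  qed
  show False
    using affine[of "- (K u u + 1) / (2 * L)"] \<open>L \<noteq> 0\<close> by (simp add: field_simps)
qed

locale pd_group = closed_orbit_group +
  assumes pd: "pd_kernel_on (range (orb G)) maxfilt"
begin

lemma max_filter_add:
  assumes xy: "aligned x y"
  shows "max_filter (x + y) u = max_filter x u + max_filter y u"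
proof -
  have sums: "aligned x (x + y)" "aligned y (x + y)"
    using xy aligned_sym[OF xy] by (auto intro: aligned_add_right aligned_refl)
  define z where "z = ((!) [x, y, x + y])"
  define c where "c = ((!) [1, 1, - 1 :: real])"
  have "maxfilt (orb G (z i)) (orb G (z j)) = z i \<bullet> z j" if "i < 3" "j < 3" for i j
    unfolding max_filter_def[symmetric] using that sums xy
    by (intro max_filter_aligned)
      (auto simp: z_def less_Suc_eq numeral_3_eq_3 intro: aligned_refl aligned_sym)
  then have "(\<Sum>i<3. \<Sum>j<3. c i * c j * maxfilt (orb G (z i)) (orb G (z j)))
      = (\<Sum>i<3. \<Sum>j<3. c i * c j * (z i \<bullet> z j))"
    by (intro sum.cong refl) auto
  also have "\<dots> = 0"
    by (simp add: z_def c_def numeral_3_eq_3 inner_add_left inner_add_right)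
  finally have "(\<Sum>i<3. c i * maxfilt (orb G (z i)) (orb G u)) = 0"
    by (intro pd_kernel_on_null[OF pd]) auto
  then show ?thesis
    by (simp add: z_def c_def numeral_3_eq_3 max_filter_def)
qed

lemma aligned_add_left_iff:
  assumes "aligned x y"
  shows "aligned (x + y) u \<longleftrightarrow> aligned x u \<and> aligned y u"
  using max_filter_add[OF assms, of u] inner_le_max_filter[of x u] inner_le_max_filter[of y u]
  by (auto simp: aligned_iff_max_filter inner_add_left)

lemma max_aligned_zero: "subspace S \<Longrightarrow> max_aligned S A \<Longrightarrow> 0 \<in> A"
  by (meson aligned_sym aligned_zero max_alignedD(3) subspace_0)

lemma max_aligned_scaleR:
  assumes "subspace S" "max_aligned S A" "a \<in> A" "0 \<le> c"
  shows "c *\<^sub>R a \<in> A"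
proof (rule max_alignedD(3)[OF assms(2)])
  show "c *\<^sub>R a \<in> S"
    using assms max_alignedD(1) by (blast intro: subspace_scale)
  show "aligned b (c *\<^sub>R a)" if "b \<in> A" for b
    using aligned_setD[OF max_alignedD(2)] assms that by (blast intro: aligned_sym aligned_scaleR)
qed

lemma max_aligned_add:
  assumes "subspace S" "max_aligned S A" "a \<in> A" "b \<in> A"
  shows "a + b \<in> A"
proof (rule max_alignedD(3)[OF assms(2)])
  show "a + b \<in> S"
    using assms max_alignedD(1) by (blast intro: subspace_add)
  show "aligned d (a + b)" if "d \<in> A" for d
    using aligned_setD[OF max_alignedD(2)] assms that by (blast intro: aligned_add_right)
qed

lemma convex_max_aligned: "subspace S \<Longrightarrow> max_aligned S A \<Longrightarrow> convex A"
  by (auto simp: convex_def intro!: max_aligned_add max_aligned_scaleR)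

lemma max_aligned_rel_interior_nonempty:
  assumes "subspace S" "max_aligned S A"
  obtains x where "x \<in> rel_interior A"
  using rel_interior_eq_empty[OF convex_max_aligned[OF assms]] max_aligned_zero[OF assms] by blast

text \<open>For \<open>x\<close> in the relative interior of \<open>A\<close> and \<open>a \<in> A\<close>, some positive multiple of \<open>x\<close> is the sum of
  a positive multiple of \<open>a\<close> and an element of \<open>A\<close>.\<close>

lemma aligned_rel_interior:
  assumes S: "subspace S" "max_aligned S A" and x: "x \<in> rel_interior A" "aligned x u" and a: "a \<in> A"
  shows "aligned a u"
proof -
  obtain e where e: "1 < e" "(1 - e) *\<^sub>R a + e *\<^sub>R x \<in> A"
    using x(1) a convex_rel_interior_iff[OF convex_max_aligned[OF S]] by blast
  define b where "b = (1 - e) *\<^sub>R a + e *\<^sub>R x"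
  have b: "b \<in> A" "b + (e - 1) *\<^sub>R a = e *\<^sub>R x"
    using e(2) by (simp_all add: b_def algebra_simps)
  have "(e - 1) *\<^sub>R a \<in> A"
    using max_aligned_scaleR[OF S a] e(1) by simp
  then have "aligned b ((e - 1) *\<^sub>R a)"
    using aligned_setD[OF max_alignedD(2)[OF S(2)] b(1)] by blast
  moreover have "aligned (b + (e - 1) *\<^sub>R a) u"
    using aligned_scaleR[OF x(2), of e] e(1) b(2) by simp
  ultimately have "aligned ((e - 1) *\<^sub>R a) u"
    using aligned_add_left_iff by blast
  from aligned_scaleR[OF this, of "1 / (e - 1)"] show ?thesis
    using e(1) by simp
qed

lemma mem_max_aligned_if_aligned_rel_interior:
  assumes "subspace S" "max_aligned S A" "x \<in> rel_interior A" "aligned x u" "u \<in> S"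
  shows "u \<in> A"
  using max_alignedD(3)[OF assms(2,5) aligned_rel_interior[OF assms(1-4)]] .

lemma max_aligned_meets_orbit:
  assumes "max_aligned UNIV A"
  shows "\<exists>g\<in>G. g z \<in> A"
proof -
  obtain x where x: "x \<in> rel_interior A"
    using max_aligned_rel_interior_nonempty[OF subspace_UNIV assms] .
  obtain g where "g \<in> G" "aligned (g z) x"
    by (rule ex_aligned_act)
  then show ?thesis
    using mem_max_aligned_if_aligned_rel_interior[OF subspace_UNIV assms x aligned_sym] by blast
qed

lemma max_aligned_conjugate:
  assumes A: "max_aligned UNIV A" and B: "max_aligned UNIV B"
  shows "\<exists>g\<in>G. B = g ` A"
proof -
  obtain x where x: "x \<in> rel_interior A"
    using max_aligned_rel_interior_nonempty[OF subspace_UNIV A] .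
  obtain g where g: "g \<in> G" "g x \<in> B"
    using max_aligned_meets_orbit[OF B] by blast
  have "B \<subseteq> g ` A"
  proof
    fix b assume "b \<in> B"
    then have "aligned (g x) (g (inv g b))"
      using aligned_setD[OF max_alignedD(2)[OF B] g(2)] by (simp add: act_inv g(1))
    then have "inv g b \<in> A"
      using mem_max_aligned_if_aligned_rel_interior[OF subspace_UNIV A x]
      by (simp add: aligned_act_iff g(1))
    then show "b \<in> g ` A"
      by (rule rev_image_eqI) (simp add: act_inv g(1))
  qed
  moreover have "g ` A \<subseteq> B"
  proof
    fix y assume "y \<in> g ` A"
    then have "aligned b y" if "b \<in> B" for b
      using \<open>B \<subseteq> g ` A\<close> that aligned_setD[OF max_alignedD(2)[OF A]]
      by (auto simp: aligned_act_iff g(1) subset_iff)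
    then show "y \<in> B"
      by (rule max_alignedD(3)[OF B UNIV_I])
  qed
  ultimately show ?thesis
    using g(1) by blast
qed

lemma span_max_aligned_span:
  assumes A: "aligned_set A" and E: "max_aligned (span A) E"
  shows "span E = span A"
proof
  show "span E \<subseteq> span A"
    using max_alignedD(1)[OF E] by (rule span_minimal) simp
  obtain x where x: "x \<in> rel_interior E"
    using max_aligned_rel_interior_nonempty[OF subspace_span E] .
  then have "x \<in> E"
    using rel_interior_subset by blast
  then have xA: "x \<in> span A"
    using max_alignedD(1)[OF E] by blast
  show "span A \<subseteq> span E"
  proof
    fix z assume z: "z \<in> span A"
    obtain s where s: "0 < s" "aligned x (x + s *\<^sub>R z)"
      using aligned_small_step[OF A xA z] .
    then have "x + s *\<^sub>R z \<in> E"
      using xA z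
      by (intro mem_max_aligned_if_aligned_rel_interior[OF subspace_span E x] span_add span_scale)
    then have "(1 / s) *\<^sub>R (x + s *\<^sub>R z - x) \<in> span E"
      using \<open>x \<in> E\<close> by (intro span_scale span_diff span_base)
    then show "z \<in> span E"
      using s(1) by simp
  qed
qed

end

subsection \<open>The section spanned by a maximal aligned set\<close>

locale fundamental_cone = pd_group +
  fixes A :: "'a set"
  assumes max_aligned_A: "max_aligned UNIV A"
begin

abbreviation \<Sigma> :: "'a set" where "\<Sigma> \<equiv> span A"

abbreviation W :: "('a \<Rightarrow> 'a) set" where "W \<equiv> weyl G \<Sigma>"

lemma aligned_set_A: "aligned_set A"
  using max_aligned_A by (rule max_alignedD)

lemma mem_A_if_aligned: "x \<in> rel_interior A \<Longrightarrow> aligned x u \<Longrightarrow> u \<in> A"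
  by (rule mem_max_aligned_if_aligned_rel_interior[OF subspace_UNIV max_aligned_A]) simp_all

sublocale weyl: orthogonal_action W \<Sigma>
  by (rule orthogonal_action_weyl) simp

lemma weyl_memD: "w \<in> W \<Longrightarrow> w \<in> G"
  by (simp add: weyl_def)

lemma weyl_aligned: "aligned x y \<Longrightarrow> weyl.aligned x y"
  by (simp add: aligned_def weyl.aligned_def weyl_memD)

lemma aligned_set_subset_translate:
  assumes "F \<subseteq> \<Sigma>" "aligned_set F"
  obtains w where "w \<in> W" "F \<subseteq> w ` A"
proof -
  obtain E where E: "max_aligned \<Sigma> E" "F \<subseteq> E"
    using ex_max_aligned[OF assms] .
  obtain B where B: "max_aligned UNIV B" "E \<subseteq> B"
    using ex_max_aligned[OF subset_UNIV max_alignedD(2)[OF E(1)]] .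
  obtain g where g: "g \<in> G" "B = g ` A"
    using max_aligned_conjugate[OF max_aligned_A B(1)] by blast
  have "\<Sigma> \<subseteq> g ` \<Sigma>"
    using span_mono[OF B(2)] span_max_aligned_span[OF aligned_set_A E(1)]
    by (simp add: g(2) linear_span_image linear_act g(1))
  moreover have "dim (g ` \<Sigma>) = dim \<Sigma>"
    using g(1) by (intro dim_image_eq linear_act inj_on_subset[OF inj_act]) auto
  ultimately have "\<Sigma> = g ` \<Sigma>"
    using g(1) by (intro subspace_dim_equal) (simp_all add: linear_subspace_image linear_act)
  then have "g \<in> W"
    using g(1) by (simp add: weyl_def)
  then show thesis
    using that E(2) B(2) g(2) by blast
qed

lemma span_cover:
  assumes "x \<in> \<Sigma>"
  obtains w a where "w \<in> W" "a \<in> A" "x = w a"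
proof -
  obtain w where "w \<in> W" "{x} \<subseteq> w ` A"
    using aligned_set_subset_translate[of "{x}"] assms
    by (auto simp: aligned_set_insert aligned_set_empty)
  then show thesis
    using that by blast
qed

lemma ex_orb_eq: "\<exists>a\<in>A. orb G x = orb G a"
  using max_aligned_meets_orbit[OF max_aligned_A, of x] orb_act by metis

lemma orb_weyl_eq:
  assumes "x \<in> \<Sigma>"
  shows "orb W x = orb G x \<inter> \<Sigma>"
proof
  show "orb W x \<subseteq> orb G x \<inter> \<Sigma>"
    using assms weyl_memD weyl.act_in_S by (auto simp: orb_def)
  show "orb G x \<inter> \<Sigma> \<subseteq> orb W x"
  proof
    fix y assume y: "y \<in> orb G x \<inter> \<Sigma>"
    then obtain g where g: "g \<in> G" "y = g x"
      by (auto simp: orb_def)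
    obtain w a where w: "w \<in> W" "a \<in> A" "x = w a"
      using span_cover[OF assms] .
    obtain v b where v: "v \<in> W" "b \<in> A" "y = v b"
      using span_cover y by blast
    have "b = (inv v \<circ> g \<circ> w) a"
      using g(2) v(3) w(3) inv_act[OF weyl_memD[OF v(1)], of b] by simp
    moreover have "inv v \<circ> g \<circ> w \<in> G"
      by (intro comp_mem inv_mem weyl_memD v(1) w(1) g(1))
    ultimately have "b = a"
      using aligned_set_unique[OF aligned_set_A w(2)] v(2) by metis
    then have "y \<in> orb W a" "orb W x = orb W a"
      using v(1,3) w(1,3) weyl.orb_mem weyl.orb_act by auto
    then show "y \<in> orb W x"
      by simp
  qed
qed

lemma section_span: "is_section G \<Sigma>"
  unfolding is_section_def
proof (intro conjI ballI)
  show "(\<Union>g\<in>G. g ` \<Sigma>) = UNIV"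
  proof -
    have "x \<in> (\<Union>g\<in>G. g ` \<Sigma>)" for x
    proof -
      obtain a where "a \<in> A" "orb G x = orb G a"
        using ex_orb_eq by blast
      then show ?thesis
        using orb_self[of x] by (auto simp: orb_def intro: span_base)
    qed
    then show ?thesis
      by blast
  qed
  fix x v s assume x: "x \<in> \<Sigma>" and v: "v \<in> tangent_space (orb G x) x" and s: "s \<in> \<Sigma>"
  obtain w a where w: "w \<in> W" "a \<in> A" "x = w a"
    using span_cover[OF x] .
  have "orthogonal v (w b)" if "b \<in> A" for b
  proof (rule tangent_space_orb_orthogonal[OF _ v])
    show "aligned x (w b)"
      using aligned_setD[OF aligned_set_A w(2) that]
      by (simp add: w(3) aligned_act_iff weyl_memD w(1))
  qed
  moreover have "span (w ` A) = \<Sigma>"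
    using w(1) by (simp add: linear_span_image linear_act weyl_def)
  ultimately show "orthogonal v s"
    using s by (auto intro: orthogonal_to_span[of s "w ` A"])
qed simp

lemma ex_orbit_representative:
  assumes "X \<in> range (orb G)"
  obtains a where "a \<in> A" "X = orb G a" "X \<inter> \<Sigma> = orb W a"
proof -
  obtain a where "a \<in> A" "X = orb G a"
    using assms ex_orb_eq by blast
  then show thesis
    using that orb_weyl_eq[OF span_base] by blast
qed

lemma bij_betw_orb_Int_span: "bij_betw (\<lambda>X. X \<inter> \<Sigma>) (range (orb G)) (orb W ` \<Sigma>)"
proof (rule bij_betw_imageI)
  show "inj_on (\<lambda>X. X \<inter> \<Sigma>) (range (orb G))"
  proof (rule inj_onI)
    fix X Y assume X: "X \<in> range (orb G)" and Y: "Y \<in> range (orb G)" and eq: "X \<inter> \<Sigma> = Y \<inter> \<Sigma>"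
    obtain a where a: "X = orb G a" "X \<inter> \<Sigma> = orb W a"
      using ex_orbit_representative[OF X] .
    obtain b where b: "Y = orb G b"
      using Y by blast
    have "a \<in> orb G b"
      using weyl.orb_self[of a] a(2) b eq by blast
    then obtain g where "g \<in> G" "a = g b"
      by (auto simp: orb_def)
    then show "X = Y"
      by (simp add: a(1) b orb_act)
  qed
  show "(\<lambda>X. X \<inter> \<Sigma>) ` range (orb G) = orb W ` \<Sigma>"
  proof (intro equalityI image_subsetI)
    fix X assume "X \<in> range (orb G)"
    then obtain a where "a \<in> A" "X \<inter> \<Sigma> = orb W a"
      using ex_orbit_representative by blast
    then show "X \<inter> \<Sigma> \<in> orb W ` \<Sigma>"
      using span_base by blast
  next
    fix x assume "x \<in> \<Sigma>"
    then show "orb W x \<in> (\<lambda>X. X \<inter> \<Sigma>) ` range (orb G)"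
      using orb_weyl_eq by blast
  qed
qed

lemma qdist_orb_Int_span:
  assumes X: "X \<in> range (orb G)" and Y: "Y \<in> range (orb G)"
  shows "qdist (X \<inter> \<Sigma>) (Y \<inter> \<Sigma>) = qdist X Y"
proof -
  obtain a where a: "a \<in> A" "X = orb G a" "X \<inter> \<Sigma> = orb W a"
    using ex_orbit_representative[OF X] .
  obtain b where b: "b \<in> A" "Y = orb G b" "Y \<inter> \<Sigma> = orb W b"
    using ex_orbit_representative[OF Y] .
  have "aligned a b"
    using aligned_setD[OF aligned_set_A a(1) b(1)] .
  then show ?thesis
    unfolding a(3) b(3) by (simp add: a(2) b(2) qdist_orb_aligned weyl.qdist_orb_aligned weyl_aligned)
qed

end

subsection \<open>The Weyl group of the section\<close>

lemma eq_hrefl_if_fixes_hyperplane: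
  assumes w: "linear w" "w v = - v" and S: "subspace S" "v \<in> S" "v \<noteq> 0" "u \<in> S"
    and fixes_hyperplane: "\<And>d. d \<in> S \<Longrightarrow> d \<bullet> v = 0 \<Longrightarrow> w d = d"
  shows "w u = hrefl v u"
proof -
  define c where "c = (u \<bullet> v) / (v \<bullet> v)"
  have "w u = w (u - c *\<^sub>R v) - c *\<^sub>R v"
    using w by (simp add: linear_diff linear_scale)
  also have "(u - c *\<^sub>R v) \<bullet> v = 0"
    using S(3) by (simp add: c_def inner_diff_left)
  then have "w (u - c *\<^sub>R v) = u - c *\<^sub>R v"
    using S by (intro fixes_hyperplane) (simp_all add: subspace_diff subspace_scale)
  also have "u - c *\<^sub>R v - c *\<^sub>R v = hrefl v u"
    by (simp add: hrefl_def c_def scaleR_2[symmetric] algebra_simps)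
  finally show ?thesis .
qed

lemma fixes_subspace_if_fixes_dual_cone:
  assumes w: "linear w" and S: "subspace S" "u \<in> S"
    and N: "finite N" "d \<in> S" "\<And>v. v \<in> N \<Longrightarrow> 0 < d \<bullet> v"
    and fixes_cone: "\<And>x. x \<in> dual_cone S N \<Longrightarrow> w x = x"
  shows "w u = u"
proof -
  have "\<forall>\<^sub>F t in at_right 0. \<forall>v\<in>N. 0 < (d + t *\<^sub>R u) \<bullet> v"
    using N(1,3) by (rule eventually_inner_pos)
  then obtain t where t: "0 < t" "\<forall>v\<in>N. 0 < (d + t *\<^sub>R u) \<bullet> v"
    by (rule eventually_at_right_ex)
  then have "w (d + t *\<^sub>R u) = d + t *\<^sub>R u" "w d = d"
    using S N(2,3) by (intro fixes_cone; simp add: dual_cone_def subspace_add subspace_scale less_imp_le)+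
  then show ?thesis
    using t(1) w by (simp add: linear_add linear_scale)
qed

lemma fixes_subspace_or_eq_hrefl:
  assumes w: "linear w" and S: "subspace S" and v: "v \<in> S" "v \<noteq> 0" "w v \<in> S" "norm (w v) = norm v"
    and fixes_wedge: "\<And>d. d \<in> dual_cone S {v, w v} \<Longrightarrow> w d = d"
  shows "(\<forall>u\<in>S. w u = u) \<or> (\<forall>u\<in>S. w u = hrefl v u)"
proof (cases "w v = - v")
  case True
  have "w d = d" if "d \<in> S" "d \<bullet> v = 0" for d
    by (rule fixes_wedge) (simp add: dual_cone_def True that)
  then have "w u = hrefl v u" if "u \<in> S" for u
    by (rule eq_hrefl_if_fixes_hyperplane[OF w True S v(1,2) that])
  then show ?thesis
    by blast
next
  case False
  define d where "d = v + w v"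
  have "w v \<bullet> w v = v \<bullet> v"
    using v(4) by (simp add: dot_square_norm)
  then have "d \<bullet> d = 2 * (d \<bullet> v)" "d \<bullet> w v = d \<bullet> v"
    by (simp_all add: d_def inner_add_left inner_add_right inner_commute)
  moreover have "0 < d \<bullet> d"
    using False by (simp add: d_def add_eq_0_iff)
  ultimately have pos: "0 < d \<bullet> x" if "x \<in> {v, w v}" for x
    using that by auto
  have "d \<in> S"
    using S v(1,3) by (simp add: d_def subspace_add)
  have "w u = u" if "u \<in> S" for u
    by (rule fixes_subspace_if_fixes_dual_cone[where N = "{v, w v}",
          OF w S that _ \<open>d \<in> S\<close> pos fixes_wedge]) simp
  then show ?thesis
    by blast
qed

context fundamental_cone
begin

lemma fixes_span_if_fixes_rel_interior:
  assumes "x \<in> rel_interior A" "g \<in> G" "g x = x" "u \<in> \<Sigma>"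
  shows "g u = u"
proof -
  have "x \<in> A"
    using assms(1) rel_interior_subset by blast
  have "g a = id a" if a: "a \<in> A" for a
  proof -
    have "aligned (g x) (g a)"
      using aligned_setD[OF aligned_set_A \<open>x \<in> A\<close> a] by (simp add: aligned_act_iff assms(2))
    then have "g a \<in> A"
      using mem_A_if_aligned assms(1,3) by simp
    then show ?thesis
      using aligned_set_unique[OF aligned_set_A a assms(2)] by simp
  qed
  then show ?thesis
    using linear_eq_on_span[OF linear_act[OF assms(2)] linear_id _ assms(4)] by simp
qed

lemma weyl_eq_on_span:
  assumes "x \<in> rel_interior A" "w \<in> W" "v \<in> W" "w x = v x" "u \<in> \<Sigma>"
  shows "w u = v u"
proof -
  have "inv v \<circ> w \<in> G"
    by (intro weyl_memD weyl.comp_mem weyl.inv_mem assms(2,3))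
  moreover have "(inv v \<circ> w) x = x"
    by (simp add: assms(4) weyl.inv_act assms(3))
  ultimately have "(inv v \<circ> w) u = u"
    by (rule fixes_span_if_fixes_rel_interior[OF assms(1) _ _ assms(5)])
  then have "v (inv v (w u)) = v u"
    by simp
  then show ?thesis
    by (simp add: weyl.act_inv assms(3))
qed

lemma finite_orb_weyl:
  assumes x: "x \<in> rel_interior A"
  shows "finite (orb W x)"
proof -
  have "x \<in> A"
    using x rel_interior_subset by blast
  have "affine hull A = \<Sigma>"
    by (intro affine_hull_span_0 hull_inc max_aligned_zero[OF subspace_UNIV max_aligned_A])
  then obtain e where e: "0 < e" "ball x e \<inter> \<Sigma> \<subseteq> A"
    using x by (auto simp: mem_rel_interior_ball)
  have "p = q" if "p \<in> orb W x" "q \<in> orb W x" "dist p q < e" for p q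
  proof -
    obtain w v where w: "w \<in> W" "p = w x" and v: "v \<in> W" "q = v x"
      using \<open>p \<in> orb W x\<close> \<open>q \<in> orb W x\<close> by (auto simp: orb_def)
    have "inv v (w x) \<in> ball x e"
      using \<open>dist p q < e\<close> weyl.dist_act[OF v(1), of x "inv v (w x)"]
      by (simp add: w v weyl.act_inv dist_commute)
    moreover have "inv v (w x) \<in> \<Sigma>"
      by (rule weyl.act_in_S[OF weyl.inv_mem[OF v(1)] weyl.act_in_S[OF w(1) span_base[OF \<open>x \<in> A\<close>]]])
    ultimately have in_A: "(inv v \<circ> w) x \<in> A"
      using e(2) by auto
    have "inv v \<circ> w \<in> G"
      by (intro weyl_memD weyl.comp_mem weyl.inv_mem v(1) w(1))
    then have "(inv v \<circ> w) x = x"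
      using in_A by (rule aligned_set_unique[OF aligned_set_A \<open>x \<in> A\<close>])
    then have "v (inv v (w x)) = v x"
      by simp
    then show ?thesis
      by (simp add: w(2) v weyl.act_inv)
  qed
  then have "uniform_discrete (orb W x)"
    unfolding uniform_discrete_def using e(1) by blast
  moreover have "bounded (orb W x)"
    by (auto simp: orb_def bounded_iff weyl.norm_act intro!: exI[of _ "norm x"])
  ultimately show ?thesis
    using uniform_discrete_finite_iff by blast
qed

lemma finite_restrictions_weyl: "finite weyl.restrictions"
proof -
  obtain x where x: "x \<in> rel_interior A"
    using max_aligned_rel_interior_nonempty[OF subspace_UNIV max_aligned_A] .
  then have "x \<in> \<Sigma>"
    using rel_interior_subset span_superset by blast
  have eqI: "restrict w \<Sigma> = restrict v \<Sigma>" if "w \<in> W" "v \<in> W" "w x = v x" for w v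
    using weyl_eq_on_span[OF x that] by (rule restrict_ext)
  have "inj_on (\<lambda>f. f x) weyl.restrictions"
    by (intro inj_onI) (auto simp: \<open>x \<in> \<Sigma>\<close> intro: eqI)
  moreover have "(\<lambda>f. f x) ` weyl.restrictions \<subseteq> orb W x"
    using \<open>x \<in> \<Sigma>\<close> by (auto simp: orb_def)
  ultimately show ?thesis
    using finite_orb_weyl[OF x] by (rule inj_on_finite)
qed

definition normals :: "'a \<Rightarrow> 'a set" where
  "normals x = (\<lambda>y. x - y) ` (orb W x - {x})"

lemma normals_subset_span: "x \<in> \<Sigma> \<Longrightarrow> normals x \<subseteq> \<Sigma>"
  by (auto simp: normals_def orb_def weyl.act_in_S intro!: span_diff)

lemma inner_normal_pos:
  assumes "v \<in> normals x"
  shows "0 < x \<bullet> v"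
proof -
  obtain w where w: "w \<in> W" "v = x - w x" and "w x \<noteq> x"
    using assms unfolding normals_def orb_def by blast
  then have "0 < v \<bullet> v"
    by simp
  also have "v \<bullet> v = 2 * (x \<bullet> v)"
    by (simp add: w(2) weyl.inner_act w(1) inner_diff_left inner_diff_right inner_commute)
  finally show ?thesis
    by simp
qed

lemma mem_A_if_weyl_aligned:
  assumes x: "x \<in> rel_interior A" and u: "u \<in> \<Sigma>" "weyl.aligned x u"
  shows "u \<in> A"
proof -
  have "x \<in> A"
    using x rel_interior_subset by blast
  obtain w a where w: "w \<in> W" "a \<in> A" "u = w a"
    using span_cover[OF u(1)] .
  have "max_filter x u = x \<bullet> a"
    using aligned_setD[OF aligned_set_A \<open>x \<in> A\<close> w(2)]
    by (simp add: w(3) max_filter_act weyl_memD w(1) max_filter_aligned)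
  also have "\<dots> = w x \<bullet> u"
    by (simp add: w(3) weyl.inner_act w(1))
  also have "\<dots> \<le> x \<bullet> u"
    using u(2) w(1) by (simp add: weyl.aligned_def)
  finally have "aligned x u"
    using inner_le_max_filter[of x u] by (simp add: aligned_iff_max_filter)
  then show ?thesis
    by (rule mem_A_if_aligned[OF x])
qed

lemma mem_dual_cone_normals_iff: "u \<in> dual_cone \<Sigma> (normals x) \<longleftrightarrow> u \<in> \<Sigma> \<and> weyl.aligned x u"
  by (force simp: dual_cone_def normals_def orb_def weyl.aligned_def inner_diff_right inner_commute)

lemma A_eq_dual_cone:
  assumes "x \<in> rel_interior A"
  shows "A = dual_cone \<Sigma> (normals x)"
proof (intro equalityI subsetI)
  have "x \<in> A"
    using assms rel_interior_subset by blast
  then show "u \<in> dual_cone \<Sigma> (normals x)" if "u \<in> A" for u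
    using that aligned_setD[OF aligned_set_A]
    by (simp add: mem_dual_cone_normals_iff span_base weyl_aligned)
  show "u \<in> A" if "u \<in> dual_cone \<Sigma> (normals x)" for u
    using that mem_A_if_weyl_aligned[OF assms] unfolding mem_dual_cone_normals_iff by blast
qed

lemma weyl_fixes_wedge_at_facet_point:
  assumes A: "A = dual_cone \<Sigma> N" "finite N" and p: "facet_point \<Sigma> N v p"
    and w: "w \<in> W" "w p = p" and "d \<in> dual_cone \<Sigma> {v, w v}"
  shows "w d = d"
proof -
  have d: "d \<in> \<Sigma>" "0 \<le> d \<bullet> v" "0 \<le> d \<bullet> w v"
    using assms(6) by (simp_all add: dual_cone_def)
  define c where "c = inv w d"
  have c: "c \<in> \<Sigma>" "0 \<le> c \<bullet> v" "w c = d"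
    using d w(1) weyl.inner_act_left[OF w(1), of v d]
    by (simp_all add: c_def weyl.act_in_S weyl.inv_mem weyl.act_inv inner_commute)
  have near: "\<forall>\<^sub>F t in at_right 0. p + t *\<^sub>R e \<in> A" if "e \<in> \<Sigma>" "0 \<le> e \<bullet> v" for e
    using eventually_facet_point_dual_cone[OF subspace_span A(2) p that] unfolding A(1)[symmetric] .
  obtain t where t: "0 < t" "p + t *\<^sub>R c \<in> A" "p + t *\<^sub>R d \<in> A"
    using eventually_conj[OF near[OF c(1,2)] near[OF d(1,2)]] by (rule eventually_at_right_ex) blast
  have "w (p + t *\<^sub>R c) = p + t *\<^sub>R d"
    using w by (simp add: linear_add linear_scale weyl.linear_act c(3))
  then have "c = d"
    using aligned_set_unique[OF aligned_set_A t(2) weyl_memD[OF w(1)]] t(1,3) by simp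
  then show ?thesis
    using c(3) by simp
qed

lemma ex_weyl_fixing_boundary_point:
  assumes p: "p \<in> A" and d: "d \<in> \<Sigma>" "\<And>s. 0 < s \<Longrightarrow> p + s *\<^sub>R d \<notin> A"
  obtains w u where "w \<in> W" "w p = p" "u \<in> \<Sigma>" "w u \<noteq> u"
proof -
  have "p \<in> \<Sigma>"
    using p by (rule span_base)
  then obtain s where s: "0 < s" "aligned p (p + s *\<^sub>R d)"
    using aligned_small_step[OF aligned_set_A _ d(1)] by blast
  have "{p, p + s *\<^sub>R d} \<subseteq> \<Sigma>" "aligned_set {p, p + s *\<^sub>R d}"
    using \<open>p \<in> \<Sigma>\<close> d(1) s(2)
    by (simp_all add: span_add span_scale aligned_set_insert aligned_set_empty aligned_sym)
  then obtain w where w: "w \<in> W" "{p, p + s *\<^sub>R d} \<subseteq> w ` A"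
    using aligned_set_subset_translate by blast
  then obtain a b where a: "a \<in> A" "p = w a" and b: "b \<in> A" "p + s *\<^sub>R d = w b"
    by blast
  have "w a = a"
    using aligned_set_unique[OF aligned_set_A a(1) weyl_memD[OF w(1)]] a(2) p by simp
  moreover have "w b \<noteq> b"
    using d(2)[OF s(1)] b by auto
  ultimately show thesis
    using that[OF w(1)] a(2) span_base[OF b(1)] by simp
qed

lemma facet_reflection:
  assumes A: "A = dual_cone \<Sigma> N" "finite N" and v: "v \<in> N" "v \<in> \<Sigma>" "v \<noteq> 0" and p: "facet_point \<Sigma> N v p"
  shows "weyl.induces (hrefl v)"
proof -
  have "p \<in> A"
    using facet_point_imp_dual_cone[OF p] unfolding A(1)[symmetric] .
  moreover have "- v \<in> \<Sigma>"
    using v(2) by (rule span_neg)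
  moreover have "p + s *\<^sub>R (- v) \<notin> A" if "0 < s" for s
  proof
    assume "p + s *\<^sub>R (- v) \<in> A"
    then have "p + s *\<^sub>R (- v) \<in> dual_cone \<Sigma> N"
      using A(1) by blast
    then have "0 \<le> (p + s *\<^sub>R (- v)) \<bullet> v"
      using v(1) by (simp add: dual_cone_def)
    then have "s * (v \<bullet> v) \<le> 0"
      using p by (simp add: facet_point_def inner_diff_left)
    moreover have "0 < s * (v \<bullet> v)"
      using that v(3) by simp
    ultimately show False
      by linarith
  qed
  ultimately obtain w u where w: "w \<in> W" "w p = p" "u \<in> \<Sigma>" "w u \<noteq> u"
    using ex_weyl_fixing_boundary_point by blast
  have "(\<forall>u\<in>\<Sigma>. w u = u) \<or> (\<forall>u\<in>\<Sigma>. w u = hrefl v u)"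
  proof (rule fixes_subspace_or_eq_hrefl)
    show "w v \<in> \<Sigma>"
      by (rule weyl.act_in_S[OF w(1) v(2)])
    show "w d = d" if "d \<in> dual_cone \<Sigma> {v, w v}" for d
      by (rule weyl_fixes_wedge_at_facet_point[OF A p w(1,2) that])
  qed (simp_all add: weyl.linear_act weyl.norm_act w(1) v(2,3))
  then show ?thesis
    using w unfolding weyl.induces_def by blast
qed

lemma ex_walls:
  assumes x: "x \<in> rel_interior A"
  obtains N where "N \<subseteq> \<Sigma>" "A = dual_cone \<Sigma> N" "\<And>v. v \<in> N \<Longrightarrow> 0 < x \<bullet> v"
    "\<And>v. v \<in> N \<Longrightarrow> weyl.induces (hrefl v)"
proof -
  have "x \<in> \<Sigma>"
    using x rel_interior_subset span_superset by blast
  have "finite (normals x)"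
    using finite_orb_weyl[OF x] by (simp add: normals_def)
  from subspace_span this \<open>x \<in> \<Sigma>\<close> inner_normal_pos
  obtain N where N: "N \<subseteq> normals x" "dual_cone \<Sigma> N = dual_cone \<Sigma> (normals x)"
    and facet: "\<forall>v\<in>N. \<exists>p. facet_point \<Sigma> N v p"
    by (rule ex_irredundant_dual_cone)
  have A: "A = dual_cone \<Sigma> N"
    using A_eq_dual_cone[OF x] N(2) by simp
  have pos: "0 < x \<bullet> v" if "v \<in> N" for v
    using N(1) inner_normal_pos that by blast
  have N_span: "N \<subseteq> \<Sigma>"
    using N(1) normals_subset_span[OF \<open>x \<in> \<Sigma>\<close>] by blast
  have walls: "weyl.induces (hrefl v)" if "v \<in> N" for v
  proof -
    obtain p where p: "facet_point \<Sigma> N v p"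
      using facet \<open>v \<in> N\<close> by blast
    have "v \<in> \<Sigma>" "v \<noteq> 0"
      using N_span pos[OF \<open>v \<in> N\<close>] \<open>v \<in> N\<close> by auto
    then show ?thesis
      using facet_reflection[OF A finite_subset[OF N(1) \<open>finite (normals x)\<close>] \<open>v \<in> N\<close> _ _ p] by blast
  qed
  show thesis
    by (rule that[OF N_span A pos walls])
qed

lemma ex_wall_raising:
  assumes N: "A = dual_cone \<Sigma> N" "\<And>v. v \<in> N \<Longrightarrow> 0 < x \<bullet> v"
    and walls: "\<And>v. v \<in> N \<Longrightarrow> weyl.induces (hrefl v)"
    and y: "y \<in> \<Sigma>" "y \<notin> A"
  obtains v r where "v \<in> N" "r \<in> W" "\<forall>u\<in>\<Sigma>. r u = hrefl v u" "x \<bullet> y < x \<bullet> r y"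
proof -
  have "y \<notin> dual_cone \<Sigma> N"
    using y(2) N(1) by blast
  then obtain v where v: "v \<in> N" "y \<bullet> v < 0"
    using y(1) by (auto simp: dual_cone_def not_le)
  obtain r where r: "r \<in> W" "\<forall>u\<in>\<Sigma>. r u = hrefl v u"
    using walls[OF v(1)] unfolding weyl.induces_def by blast
  have "0 < v \<bullet> v"
    using N(2)[OF v(1)] by auto
  then have "x \<bullet> y < x \<bullet> r y"
    using r(2) y(1) v(2) N(2)[OF v(1)]
    by (simp add: hrefl_def inner_diff_right mult_neg_pos divide_neg_pos)
  then show thesis
    using that v(1) r by blast
qed

lemma weyl_eq_wall_word:
  assumes x: "x \<in> rel_interior A" and N: "A = dual_cone \<Sigma> N" "\<And>v. v \<in> N \<Longrightarrow> 0 < x \<bullet> v"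
    and walls: "\<And>v. v \<in> N \<Longrightarrow> weyl.induces (hrefl v)" and "w \<in> W"
  shows "\<exists>vs\<in>lists N. \<forall>u\<in>\<Sigma>. w u = refl_word vs u"
  using \<open>w \<in> W\<close>
proof (induction "card {p \<in> orb W x. x \<bullet> w x < x \<bullet> p}" arbitrary: w rule: less_induct)
  case less
  have "x \<in> A"
    using x rel_interior_subset by blast
  then have wx: "w x \<in> \<Sigma>"
    using weyl.act_in_S[OF less.prems span_base] by blast
  show ?case
  proof (cases "w x \<in> A")
    case True
    then have "w x = id x"
      using aligned_set_unique[OF aligned_set_A \<open>x \<in> A\<close> weyl_memD[OF less.prems]] by simp
    then have "\<forall>u\<in>\<Sigma>. w u = id u"
      using weyl_eq_on_span[OF x less.prems weyl.id_mem] by blast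
    then show ?thesis
      by (intro bexI[of _ "[]"]) simp_all
  next
    case False
    then obtain v r where v: "v \<in> N" and r: "r \<in> W" "\<forall>u\<in>\<Sigma>. r u = hrefl v u" "x \<bullet> w x < x \<bullet> r (w x)"
      using ex_wall_raising[OF N walls wx] by blast
    have rw: "r \<circ> w \<in> W"
      by (rule weyl.comp_mem[OF r(1) less.prems])
    have "{p \<in> orb W x. x \<bullet> (r \<circ> w) x < x \<bullet> p} \<subset> {p \<in> orb W x. x \<bullet> w x < x \<bullet> p}"
      using r(3) weyl.orb_mem[OF rw, of x] by (intro psubsetI) auto
    then have "card {p \<in> orb W x. x \<bullet> (r \<circ> w) x < x \<bullet> p} < card {p \<in> orb W x. x \<bullet> w x < x \<bullet> p}"
      using finite_orb_weyl[OF x] by (intro psubset_card_mono) auto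
    then obtain vs where vs: "vs \<in> lists N" "\<forall>u\<in>\<Sigma>. (r \<circ> w) u = refl_word vs u"
      using less.hyps[OF _ rw] by blast
    have "w u = refl_word (v # vs) u" if "u \<in> \<Sigma>" for u
      using vs(2) r(2) weyl.act_in_S[OF less.prems that] that by auto
    then show ?thesis
      using v vs(1) by (intro bexI[of _ "v # vs"]) auto
  qed
qed

lemma finite_reflection_group_weyl: "finite_reflection_group_on \<Sigma> weyl.restrictions"
proof -
  obtain x where x: "x \<in> rel_interior A"
    using max_aligned_rel_interior_nonempty[OF subspace_UNIV max_aligned_A] .
  obtain N where N: "N \<subseteq> \<Sigma>" "A = dual_cone \<Sigma> N" "\<And>v. v \<in> N \<Longrightarrow> 0 < x \<bullet> v"
    and walls: "\<And>v. v \<in> N \<Longrightarrow> weyl.induces (hrefl v)"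
    by (rule ex_walls[OF x]) blast
  show ?thesis
  proof (rule weyl.finite_reflection_group_onI[OF finite_restrictions_weyl N(1) _ walls])
    show "0 \<notin> N"
      using N(3)[of 0] by auto
    show "\<exists>vs\<in>lists N. \<forall>u\<in>\<Sigma>. w u = refl_word vs u" if "w \<in> W" for w
      by (rule weyl_eq_wall_word[OF x N(2,3) walls that])
  qed
qed

end

theorem theorem38:
  fixes G :: "('a::euclidean_space \<Rightarrow> 'a) set"
  assumes "orth_group G"
    and "\<forall>x. closed (orb G x)"
  shows "pd_kernel_on (range (orb G)) maxfilt \<longleftrightarrow>
    (\<exists>\<Sigma>. is_section G \<Sigma> \<and>
       (\<exists>f. bij_betw f (range (orb G)) (orb (weyl G \<Sigma>) ` \<Sigma>) \<and>
            (\<forall>A\<in>range (orb G). \<forall>B\<in>range (orb G). qdist (f A) (f B) = qdist A B)) \<and>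
       finite_reflection_group_on \<Sigma> ((\<lambda>g. restrict g \<Sigma>) ` weyl G \<Sigma>))"
    (is "?pd \<longleftrightarrow> (\<exists>\<Sigma>. ?polar \<Sigma>)")
proof
  assume ?pd
  then interpret pd_group G
    using assms by unfold_locales auto
  obtain A where "max_aligned UNIV A"
    using ex_max_aligned[OF empty_subsetI aligned_set_empty] .
  then interpret fundamental_cone G A
    by unfold_locales
  show "\<exists>\<Sigma>. ?polar \<Sigma>"
    using section_span bij_betw_orb_Int_span qdist_orb_Int_span finite_reflection_group_weyl by blast
next
  interpret closed_orbit_group G
    using assms by unfold_locales auto
  assume "\<exists>\<Sigma>. ?polar \<Sigma>"
  then obtain \<Sigma> f where "subspace \<Sigma>"
    and f: "bij_betw f (range (orb G)) (orb (weyl G \<Sigma>) ` \<Sigma>)"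
      "\<And>X Y. X \<in> range (orb G) \<Longrightarrow> Y \<in> range (orb G) \<Longrightarrow> qdist (f X) (f Y) = qdist X Y"
    and "finite_reflection_group_on \<Sigma> ((\<lambda>g. restrict g \<Sigma>) ` weyl G \<Sigma>)"
    unfolding is_section_def by blast
  then have "finite_reflection_action (weyl G \<Sigma>) \<Sigma>"
    by (intro finite_reflection_action_weyl)
  then show ?pd
    by (rule pd_kernel_if_isometric_to_reflection_quotient[where f = f])
      (simp_all add: bij_betw_imp_surj_on[OF f(1)] f(2))
qed

end
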